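(* Let $\psi:\mathbb{N}\to\mathbb{R}^+$ be a non-increasing function. Let $\gamma,\beta$ be irrational real numbers such that the pair $(\gamma,\beta)$ is Diophantine, and let $\gamma'$ be a real number. Suppose that $\sum_{q=1}^\infty\psi(q)\log q=\infty$. Then $$|W(\psi,\beta,\gamma,\gamma')|=1.$$
   Context: $\mathbb{N}=\{1,2,3,\dots\}$ and $\mathbb{R}^+=(0,\infty)$. For real $x$, $\|x\|$ is the distance from $x$ to the nearest integer. $|A|$ denotes the Lebesgue measure of a measurable set $A\subset\mathbb{R}$. $\log$ is the base $2$ logarithm. For $\psi:\mathbb{N}\to\mathbb{R}^+$ and real numbers $\beta,\gamma,\gamma'$, $$W(\psi,\beta,\gamma,\gamma')=\{x\in[0,1]:\ \|qx-\gamma\|\,\|q\beta-\gamma'\|<\psi(q)\text{ for infinitely many } q\in\mathbb{N}\}.$$ A pair $(\gamma_1,\gamma_2)$ of $\mathbb{Q}$-linearly independent real numbers is called Diophantine if there are $\rho,c>0$ such that $\|n_1\gamma_1+n_2\gamma_2\|\ge c\,(\max\{|n_1|,|n_2|\})^{-\rho}$ for all $(n_1,n_2)\in\mathbb{Z}^2\setminus\{(0,0)\}$. *)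

theory Defs
  imports "HOL-Analysis.Analysis"
begin

definition nearest_int_dist :: "real \<Rightarrow> real" where
  "nearest_int_dist x = dist x (of_int (round x))"

definition rat_lin_indep_pair :: "real \<Rightarrow> real \<Rightarrow> bool" where
  "rat_lin_indep_pair x y \<longleftrightarrow>
     (\<forall>a b :: rat. of_rat a * x + of_rat b * y = 0 \<longrightarrow> a = 0 \<and> b = 0)"

definition Diophantine_pair :: "real \<Rightarrow> real \<Rightarrow> bool" where
  "Diophantine_pair g1 g2 \<longleftrightarrow>
     rat_lin_indep_pair g1 g2 \<and>
     (\<exists>\<rho>>0. \<exists>c>0. \<forall>n1 n2 :: int. (n1, n2) \<noteq> (0, 0) \<longrightarrow>
        nearest_int_dist (of_int n1 * g1 + of_int n2 * g2)
          \<ge> c * real_of_int (max \<bar>n1\<bar> \<bar>n2\<bar>) powr (- \<rho>))"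

(* The natural numbers of the source start at 1, so the value of psi at 0 is never used. *)
definition W :: "(nat \<Rightarrow> real) \<Rightarrow> real \<Rightarrow> real \<Rightarrow> real \<Rightarrow> real set" where
  "W \<psi> \<beta> \<gamma> \<gamma>' =
     {x \<in> {0..1}. infinite {q :: nat. q \<ge> 1 \<and>
        nearest_int_dist (real q * x - \<gamma>) * nearest_int_dist (real q * \<beta> - \<gamma>') < \<psi> q}}"

end

theory Submission
  imports Defs "HOL-Probability.Probability" "HOL-Number_Theory.Cong" "HOL-Real_Asymp.Real_Asymp"
begin

text \<open>
  Put \<open>\<delta> q = min (\<psi> q) (1/q) / \<parallel>q\<beta> - \<gamma>'\<parallel>\<close> for those \<open>q\<close>, \<open>2^k \<le> q < 2^(k+1)\<close>, with
  \<open>2^(-3t) \<le> \<parallel>q\<beta> - \<gamma>'\<parallel> < 2^(-2t)\<close>, where \<open>t\<close> is a small multiple of \<open>k\<close>, and \<open>\<delta> q = 0\<close> otherwise. As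
  \<open>\<beta>\<close> is Diophantine, each of the \<open>t\<close> dyadic levels of \<open>\<parallel>q\<beta> - \<gamma>'\<parallel>\<close> contributes about \<open>2^k\<close> to the sum of
  \<open>1 / \<parallel>q\<beta> - \<gamma>'\<parallel>\<close>; this gives the logarithm, so the sum of the \<open>\<delta> q\<close> diverges.

  The sets \<open>A q = {x. \<parallel>qx - \<gamma>\<parallel> < \<delta> q}\<close> satisfy
  \<open>|A q \<inter> A r| \<le> |A q| |A r| + 2 gcd(q,r) \<delta> r / r\<close>, and are disjoint unless
  \<open>\<parallel>\<gamma>(r - q)/gcd(q,r)\<parallel>\<close> is small. The total of the error terms over all pairs is finite: for small gcd
  because both \<open>q\<close> and \<open>r\<close> lie in sparse Bohr sets, which are equidistributed along multiples of the
  gcd, and for large gcd because \<open>\<gamma>\<close> is Diophantine. Hence the variance of the counting function is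
  bounded by its mean plus a constant, and Chebyshev's inequality yields full measure.
\<close>

section \<open>Distance to the nearest integer and rational rotations\<close>

text \<open>The obstacle is the gcd term in the overlap bound: as \<psi> is only monotone, the mean
  may grow arbitrarily slowly, so the errors have to be bounded by a constant. The thin window
  achieves this. Within block \<open>k\<close> there are about 2^(2k - 4t) pairs, with \<delta> r /
  r at most about 2^(3t - 2k); this leaves 2^(-t), up to a factor linear in \<open>k\<close> from
  the sum over the gcd, and is summable since \<open>t\<close> is proportional to \<open>k\<close>.
  For blocks \<open>k\<close> < \<open>l\<close> a further factor decaying exponentially in
  \<open>l - k\<close> appears. Equidistribution along multiples of \<open>d\<close> requires a
  denominator \<open>s\<close> of an approximation to \<open>d * \<beta>\<close> with
  \<open>d * s\<close> at most 2^k, so it stops at a fixed power of 2^t; this is why large gcds are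
  treated by disjointness instead. Truncating \<psi> at 1/q makes the bound on the radii independent
  of \<psi>.\<close>

abbreviation nid :: "real \<Rightarrow> real" where
  "nid \<equiv> nearest_int_dist"

lemma nid_le: "nid x \<le> \<bar>x - of_int n\<bar>"
  unfolding nearest_int_dist_def dist_real_def by (rule round_diff_minimal)

lemma nid_obtain:
  obtains n where "nid x = \<bar>x - of_int n\<bar>"
  unfolding nearest_int_dist_def dist_real_def by blast

lemma nid_nonneg [simp]: "0 \<le> nid x"
  by (simp add: nearest_int_dist_def)

lemma nid_less_iff: "nid x < e \<longleftrightarrow> (\<exists>n::int. \<bar>x - of_int n\<bar> < e)"
  by (metis le_less_trans nid_le nid_obtain)

lemma nid_add_of_int [simp]: "nid (x + of_int n) = nid x"
proof (rule antisym)
  obtain m where "nid x = \<bar>x - of_int m\<bar>" by (rule nid_obtain)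
  then show "nid (x + of_int n) \<le> nid x"
    using nid_le[of "x + of_int n" "m + n"] by simp
  obtain m where "nid (x + of_int n) = \<bar>x + of_int n - of_int m\<bar>" by (rule nid_obtain)
  then show "nid x \<le> nid (x + of_int n)"
    using nid_le[of x "m - n"] by (simp add: algebra_simps)
qed

lemma nid_minus [simp]: "nid (- x) = nid x"
proof -
  have "nid (- x) \<le> nid x" for x
  proof -
    obtain m where "nid x = \<bar>x - of_int m\<bar>" by (rule nid_obtain)
    then show ?thesis using nid_le[of "- x" "- m"] by simp
  qed
  from this[of x] this[of "- x"] show ?thesis by simp
qed

lemma nid_add_le: "nid (x + y) \<le> nid x + nid y"
proof -
  obtain m where m: "nid x = \<bar>x - of_int m\<bar>" by (rule nid_obtain)
  obtain n where n: "nid y = \<bar>y - of_int n\<bar>" by (rule nid_obtain)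
  show ?thesis using nid_le[of "x + y" "m + n"] unfolding m n by simp
qed

lemma nid_diff_le: "nid (x - y) \<le> nid x + nid y"
  using nid_add_le[of x "- y"] by simp

lemma nid_mult_nat_le: "nid (real n * x) \<le> real n * nid x"
proof -
  obtain m where m: "nid x = \<bar>x - of_int m\<bar>" by (rule nid_obtain)
  have "nid (real n * x) \<le> \<bar>real n * x - of_int (int n * m)\<bar>" by (rule nid_le)
  also have "\<dots> = real n * nid x"
    unfolding m by (simp add: abs_mult mult.assoc flip: right_diff_distrib)
  finally show ?thesis .
qed

section \<open>Visits of a rotation to an interval\<close>

lemma card_int_open_interval:
  fixes a :: real
  assumes "0 \<le> l"
  shows "finite {v::int. a < of_int v \<and> of_int v < a + l}"
    and "real (card {v::int. a < of_int v \<and> of_int v < a + l}) \<le> l + 1"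
proof -
  have sub: "{v::int. a < of_int v \<and> of_int v < a + l} \<subseteq> {\<lfloor>a\<rfloor>+1..\<lceil>a + l\<rceil> - 1}"
    by (auto simp: floor_less_iff le_floor_iff less_ceiling_iff) linarith+
  show "finite {v::int. a < of_int v \<and> of_int v < a + l}"
    using sub finite_subset by blast
  have "card {v::int. a < of_int v \<and> of_int v < a + l} \<le> card {\<lfloor>a\<rfloor>+1..\<lceil>a + l\<rceil> - 1}"
    by (intro card_mono sub) simp
  then have "real (card {v::int. a < of_int v \<and> of_int v < a + l}) \<le> real (nat (\<lceil>a + l\<rceil> - 1 - \<lfloor>a\<rfloor>))"
    by simp
  also have "\<dots> \<le> l + 1"
  proof -
    have "real_of_int (\<lceil>a + l\<rceil> - 1 - \<lfloor>a\<rfloor>) \<le> l + 1" by linarith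
    then show ?thesis using assms by linarith
  qed
  finally show "real (card {v::int. a < of_int v \<and> of_int v < a + l}) \<le> l + 1" .
qed

lemma card_int_half_open_interval:
  fixes a :: real
  shows "finite {v::int. a \<le> of_int v \<and> of_int v < a + l}"
    and "l - 1 \<le> real (card {v::int. a \<le> of_int v \<and> of_int v < a + l})"
proof -
  have eq: "{v::int. a \<le> of_int v \<and> of_int v < a + l} = {\<lceil>a\<rceil>..\<lceil>a + l\<rceil> - 1}"
    by (auto simp: ceiling_le_iff less_ceiling_iff)
  show "finite {v::int. a \<le> of_int v \<and> of_int v < a + l}" unfolding eq by simp
  show "l - 1 \<le> real (card {v::int. a \<le> of_int v \<and> of_int v < a + l})"
    unfolding eq by simp linarith
qed

text \<open>After multiplication by \<open>s\<close> the visits become integers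
  \<open>i * p - s * n\<close> in an open interval of length \<open>2 * \<delta> * s\<close>. They
  are distinct because \<open>p\<close> is invertible modulo \<open>s\<close>.\<close>

lemma card_rational_rotation_le:
  fixes p :: int and z \<delta> :: real
  assumes "coprime p (int s)" "0 < s" "0 \<le> \<delta>"
  shows "real (card {i. i < s \<and> nid (z + real i * (of_int p / real s)) < \<delta>}) \<le> 2 * \<delta> * real s + 1"
proof -
  let ?I = "{i. i < s \<and> nid (z + real i * (of_int p / real s)) < \<delta>}"
  let ?a = "- (real s * z) - \<delta> * real s"
  let ?V = "{v::int. ?a < of_int v \<and> of_int v < ?a + 2 * \<delta> * real s}"
  have "\<forall>i\<in>?I. \<exists>n::int. \<bar>z + real i * (of_int p / real s) - of_int n\<bar> < \<delta>"
    by (auto simp: nid_less_iff)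
  from bchoice[OF this] obtain n :: "nat \<Rightarrow> int"
    where n: "\<And>i. i \<in> ?I \<Longrightarrow> \<bar>z + real i * (of_int p / real s) - of_int (n i)\<bar> < \<delta>"
    by blast
  define v where "v i = int i * p - int s * n i" for i
  have "v i \<in> ?V" if "i \<in> ?I" for i
  proof -
    have "real_of_int (v i) + real s * z = real s * (z + real i * (of_int p / real s) - of_int (n i))"
      using \<open>0 < s\<close> by (simp add: v_def field_simps)
    then have "\<bar>real_of_int (v i) + real s * z\<bar> < real s * \<delta>"
      using n[OF that] \<open>0 < s\<close> by (simp add: abs_mult)
    then show ?thesis by (auto simp: algebra_simps abs_less_iff)
  qed
  moreover have "inj_on v ?I"
  proof (rule inj_onI)
    fix i j assume ij: "i \<in> ?I" "j \<in> ?I" "v i = v j"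
    then have "(int i - int j) * p = int s * (n i - n j)" by (simp add: v_def algebra_simps)
    then have "int s dvd (int i - int j) * p" by simp
    then have "int s dvd int i - int j"
      using assms(1) by (metis coprime_commute coprime_dvd_mult_left_iff)
    moreover have "\<bar>int i - int j\<bar> < int s" using ij by auto
    ultimately have "int i - int j = 0"
      using zdvd_imp_le[of "int s" "\<bar>int i - int j\<bar>"] by force
    then show "i = j" by simp
  qed
  ultimately have "card ?I \<le> card ?V"
    by (intro card_inj_on_le[of v] card_int_open_interval(1)) (use assms in auto)
  then show ?thesis
    using card_int_open_interval(2)[of "2 * \<delta> * real s" ?a] assms(3) by (auto intro: order_trans[rotated])
qed

text \<open>As \<open>p\<close> is invertible modulo \<open>s\<close>, every integer
  \<open>v\<close> equals \<open>i * p - s * n\<close> for some \<open>i < s\<close>. The bound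
  \<open>hi \<le> lo + 1\<close> keeps the relevant \<open>v\<close> in a half-open window of length
  at most \<open>s\<close>, so different \<open>v\<close> come from different
  \<open>i\<close>.\<close>

lemma card_rational_rotation_ge:
  fixes p :: int and z lo hi :: real
  assumes "coprime p (int s)" "0 < s" "hi \<le> lo + 1"
  shows "(hi - lo) * real s - 1 \<le> real (card {i. i < s \<and>
           (\<exists>n::int. lo \<le> z + real i * (of_int p / real s) - of_int n \<and>
                    z + real i * (of_int p / real s) - of_int n < hi)})"
    (is "_ \<le> real (card ?I)")
proof -
  let ?a = "real s * lo - real s * z"
  let ?V = "{v::int. ?a \<le> of_int v \<and> of_int v < ?a + (hi - lo) * real s}"
  have "\<exists>i n. i < s \<and> int i * p - int s * n = v" for v :: int
  proof -
    obtain x where "[p * x = 1] (mod int s)"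
      using cong_solve_coprime_int assms(1) by blast
    then have "[p * (x * v) = v] (mod int s)"
      using cong_scalar_right[of "p * x" 1 "int s" v] by (simp add: mult.assoc)
    then have "[p * ((x * v) mod int s) = v] (mod int s)"
      by (simp add: cong_def mod_mult_right_eq)
    moreover define i where "i = nat ((x * v) mod int s)"
    have "int i = (x * v) mod int s" using \<open>0 < s\<close> by (simp add: i_def)
    ultimately have "[int i * p = v] (mod int s)" by (simp add: mult.commute)
    then obtain n where "int i * p - v = int s * n"
      by (metis cong_iff_dvd_diff dvdE)
    moreover have "i < s" using \<open>int i = _\<close> \<open>0 < s\<close>
      by (metis of_nat_0_less_iff of_nat_less_iff pos_mod_bound)
    ultimately show ?thesis by (intro exI[of _ i] exI[of _ n]) simp
  qed
  then obtain f n where f: "\<And>v. f v < s" "\<And>v. int (f v) * p - int s * n v = v" by metis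
  have "f v \<in> ?I" if "v \<in> ?V" for v
  proof -
    have "real_of_int v + real s * z = real s * (z + real (f v) * (of_int p / real s) - of_int (n v))"
      using \<open>0 < s\<close> by (subst f(2)[of v, symmetric]) (simp add: field_simps)
    moreover have "real s * lo \<le> real_of_int v + real s * z" "real_of_int v + real s * z < real s * hi"
      using that by (auto simp: algebra_simps)
    ultimately have "lo \<le> z + real (f v) * (of_int p / real s) - of_int (n v)"
      "z + real (f v) * (of_int p / real s) - of_int (n v) < hi"
      using \<open>0 < s\<close> by (simp_all only: mult_le_cancel_left_pos mult_less_cancel_left_pos of_nat_0_less_iff)
    then show ?thesis using f(1) by blast
  qed
  moreover have "inj_on f ?V"
  proof (rule inj_onI)
    fix u v assume uv: "u \<in> ?V" "v \<in> ?V" "f u = f v"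
    then have "u - v = int s * (n v - n u)"
      using f(2)[of u] f(2)[of v] by (simp add: algebra_simps)
    then have "int s dvd u - v" by simp
    moreover have "\<bar>real_of_int u - real_of_int v\<bar> < real s"
    proof -
      have "(hi - lo) * real s \<le> 1 * real s" using assms(3) by (intro mult_right_mono) auto
      then show ?thesis using uv by auto
    qed
    then have "\<bar>u - v\<bar> < int s" by linarith
    ultimately have "u - v = 0" 
      using zdvd_imp_le[of "int s" "\<bar>u - v\<bar>"] by force
    then show "u = v" by simp
  qed
  ultimately have "card ?V \<le> card ?I"
    by (intro card_inj_on_le[of f]) auto
  then show ?thesis
    using card_int_half_open_interval(2)[of "(hi - lo) * real s" ?a] by linarith
qed

text \<open>The quality 1/s^2 of the approximation keeps the drift over \<open>s\<close> steps below
  the spacing 1/s of the rational orbit; replacing \<alpha> by p/s therefore changes the number of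
  visits only by a constant.\<close>

lemma rotation_perturb:
  fixes \<alpha> :: real and p :: int
  assumes "\<bar>\<alpha> - of_int p / real s\<bar> \<le> 1 / (real s)^2" "i < s"
  shows "\<bar>real i * \<alpha> - real i * (of_int p / real s)\<bar> \<le> 1 / real s"
proof -
  have "\<bar>real i * \<alpha> - real i * (of_int p / real s)\<bar> = real i * \<bar>\<alpha> - of_int p / real s\<bar>"
    by (simp add: abs_mult flip: right_diff_distrib del: times_divide_eq_right)
  also have "\<dots> \<le> real s * (1 / (real s)^2)"
    using assms by (intro mult_mono) auto
  also have "\<dots> = 1 / real s" by (simp add: power2_eq_square)
  finally show ?thesis .
qed

lemma card_rotation_le:
  fixes \<alpha> z \<epsilon> :: real and p :: int
  assumes "coprime p (int s)" "0 < s" "0 \<le> \<epsilon>" and \<alpha>: "\<bar>\<alpha> - of_int p / real s\<bar> \<le> 1 / (real s)^2"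
  shows "real (card {i. i < s \<and> nid (z + real i * \<alpha>) < \<epsilon>}) \<le> 2 * \<epsilon> * real s + 3"
proof -
  have "nid (z + real i * (of_int p / real s)) < \<epsilon> + 1 / real s"
    if "i < s" "nid (z + real i * \<alpha>) < \<epsilon>" for i
  proof -
    obtain n :: int where "\<bar>z + real i * \<alpha> - of_int n\<bar> < \<epsilon>"
      using \<open>nid (z + real i * \<alpha>) < \<epsilon>\<close> nid_less_iff by blast
    then have "\<bar>z + real i * (of_int p / real s) - of_int n\<bar> < \<epsilon> + 1 / real s"
      using rotation_perturb[OF \<alpha> that(1)] by linarith
    then show ?thesis unfolding nid_less_iff by blast
  qed
  then have "card {i. i < s \<and> nid (z + real i * \<alpha>) < \<epsilon>}
     \<le> card {i. i < s \<and> nid (z + real i * (of_int p / real s)) < \<epsilon> + 1 / real s}"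
    by (intro card_mono) auto
  moreover have "real (card {i. i < s \<and> nid (z + real i * (of_int p / real s)) < \<epsilon> + 1 / real s})
     \<le> 2 * (\<epsilon> + 1 / real s) * real s + 1"
    using assms by (intro card_rational_rotation_le) auto
  moreover have "2 * (\<epsilon> + 1 / real s) * real s + 1 = 2 * \<epsilon> * real s + 3"
    using \<open>0 < s\<close> by (simp add: field_simps)
  ultimately show ?thesis by linarith
qed

lemma nid_eq_abs: "\<bar>x - of_int n\<bar> < 1/2 \<Longrightarrow> nid x = \<bar>x - of_int n\<bar>"
  using round_unique'[of x n] by (simp add: nearest_int_dist_def dist_real_def)

text \<open>Only orbit points to the right of an integer are counted; \<open>b \<le> 1/2\<close>
  makes their signed distance the distance to the nearest integer. Shrinking the interval by 1/s at
  both ends pays for replacing \<alpha> by p/s and costs 2; the rounding costs 1 more.\<close>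

lemma card_rotation_ge:
  fixes \<alpha> z a b :: real and p :: int
  assumes "coprime p (int s)" "0 < s" "0 \<le> a" "b \<le> 1/2"
    and \<alpha>: "\<bar>\<alpha> - of_int p / real s\<bar> \<le> 1 / (real s)^2"
  shows "(b - a) * real s - 3 \<le> real (card {i. i < s \<and> a \<le> nid (z + real i * \<alpha>) \<and> nid (z + real i * \<alpha>) < b})"
    (is "_ \<le> real (card ?I)")
proof -
  let ?J = "{i. i < s \<and> (\<exists>n::int. a + 1 / real s \<le> z + real i * (of_int p / real s) - of_int n \<and>
                    z + real i * (of_int p / real s) - of_int n < b - 1 / real s)}"
  have s1: "1 / real s > 0" using \<open>0 < s\<close> by simp
  have "((b - 1 / real s) - (a + 1 / real s)) * real s - 1 \<le> real (card ?J)"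
    by (intro card_rational_rotation_ge) (use assms s1 in linarith)+
  moreover have "card ?J \<le> card ?I"
  proof (intro card_mono subsetI)
    fix i assume "i \<in> ?J"
    then obtain n :: int where i: "i < s" "a + 1 / real s \<le> z + real i * (of_int p / real s) - of_int n"
                    "z + real i * (of_int p / real s) - of_int n < b - 1 / real s" by blast
    then have ab: "a \<le> z + real i * \<alpha> - of_int n" "z + real i * \<alpha> - of_int n < b"
      using rotation_perturb[OF \<alpha> i(1)] by linarith+
    then have "nid (z + real i * \<alpha>) = z + real i * \<alpha> - of_int n"
      using nid_eq_abs[of "z + real i * \<alpha>" n] assms by linarith
    then show "i \<in> ?I" using ab i by simp
  qed simp
  moreover have "((b - 1 / real s) - (a + 1 / real s)) * real s - 1 = (b - a) * real s - 3"
    using \<open>0 < s\<close> by (simp add: field_simps)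
  ultimately show ?thesis by linarith
qed

lemma card_split_blocks:
  fixes N s n0 :: nat
  shows "card {n \<in> {n0..<n0 + N * s}. P n} = (\<Sum>i<N. card {m. m < s \<and> P (n0 + i * s + m)})"
proof (induction N)
  case (Suc N)
  let ?f = "\<lambda>m. n0 + N * s + m"
  have "{n \<in> {n0..<n0 + Suc N * s}. P n} = {n \<in> {n0..<n0 + N * s}. P n} \<union> ?f ` {m. m < s \<and> P (?f m)}"
  proof (intro equalityI subsetI)
    fix n assume n: "n \<in> {n \<in> {n0..<n0 + Suc N * s}. P n}"
    show "n \<in> {n \<in> {n0..<n0 + N * s}. P n} \<union> ?f ` {m. m < s \<and> P (?f m)}"
    proof (cases "n < n0 + N * s")
      case False
      then have "n = ?f (n - (n0 + N * s))" "n - (n0 + N * s) < s" using n by auto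
      then show ?thesis using n by (intro UnI2 image_eqI[of _ _ "n - (n0 + N * s)"]) auto
    qed (use n in auto)
  qed auto
  then have "card {n \<in> {n0..<n0 + Suc N * s}. P n}
    = card {n \<in> {n0..<n0 + N * s}. P n} + card (?f ` {m. m < s \<and> P (?f m)})"
    by (simp only:) (intro card_Un_disjoint; auto)
  also have "card (?f ` {m. m < s \<and> P (?f m)}) = card {m. m < s \<and> P (?f m)}"
    by (intro card_image) (auto simp: inj_on_def)
  finally show ?case using Suc.IH by simp
qed simp

section \<open>Overlaps of neighbourhoods of shifted fractions\<close>

lemma borel_measurable_nid [measurable]: "nid \<in> borel_measurable borel"
proof -
  have "nid = (\<lambda>x. \<bar>x - of_int \<lfloor>x + 1/2\<rfloor>\<bar>)"
    by (simp add: fun_eq_iff nearest_int_dist_def dist_real_def round_def)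
  moreover have "(\<lambda>x::real. \<bar>x - of_int \<lfloor>x + 1/2\<rfloor>\<bar>) \<in> borel_measurable borel"
    by measurable
  ultimately show ?thesis by simp
qed

section \<open>Lebesgue measure of periodic sets\<close>

lemma measure_lborel_shift:
  fixes h :: real
  assumes [measurable]: "S \<in> sets borel"
  shows "measure lborel {x. x + h \<in> S} = measure lborel S"
proof -
  have "measure lborel S = measure (distr lborel borel ((+) h)) S"
    by (simp add: lborel_distr_plus)
  also have "\<dots> = measure lborel {x. x + h \<in> S}"
    by (subst measure_distr) (auto simp: vimage_def add.commute)
  finally show ?thesis by simp
qed

lemma sets_borel_shift:
  fixes h :: real
  assumes [measurable]: "S \<in> sets borel"
  shows "{x. x + h \<in> S} \<in> sets borel"
proof -
  have "{x \<in> space borel. x + h \<in> S} \<in> sets borel" by measurable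
  then show ?thesis by simp
qed

lemma fmeasurable_lborel_bounded:
  "S \<in> sets borel \<Longrightarrow> S \<subseteq> {a..b::real} \<Longrightarrow> S \<in> fmeasurable lborel"
  by (rule fmeasurableI2[of "{a..b}"]) (auto simp: fmeasurable_def emeasure_lborel_Icc_eq)

lemma measure_Un_fmeasurable_disjoint:
  "A \<in> fmeasurable M \<Longrightarrow> B \<in> fmeasurable M \<Longrightarrow> A \<inter> B = {} \<Longrightarrow>
    measure M (A \<union> B) = measure M A + measure M B"
  by (intro measure_Un_AE always_eventually) auto

lemma measure_periodic_shift:
  fixes E :: "real set"
  assumes E [measurable]: "E \<in> sets borel" and per: "\<And>x. x + 1 \<in> E \<longleftrightarrow> x \<in> E"
    and h: "0 \<le> h" "h \<le> 1"
  shows "measure lborel ({0..<1} \<inter> {x. x + h \<in> E}) = measure lborel ({0..<1} \<inter> E)"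
proof -
  have "{0..<1} \<inter> {x. x + h \<in> E} = {x. x + h \<in> {h..<1+h} \<inter> E}" by auto
  then have "measure lborel ({0..<1} \<inter> {x. x + h \<in> E}) = measure lborel ({h..<1+h} \<inter> E)"
    by (simp only: measure_lborel_shift E sets.Int atLeastLessThan_borel)
  \<comment> \<open>The window is cut at 1; periodicity moves the part beyond 1 back to the missing
    piece \<open>{0..<h}\<close>.\<close>
  also have "{h..<1+h} \<inter> E = ({h..<1} \<inter> E) \<union> ({1..<1+h} \<inter> E)" using h by auto
  also have "measure lborel \<dots> = measure lborel ({h..<1} \<inter> E) + measure lborel ({1..<1+h} \<inter> E)"
    by (rule measure_Un_fmeasurable_disjoint)
       (use h in \<open>auto intro!: fmeasurable_lborel_bounded[of _ 0 2]\<close>)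
  also have "measure lborel ({1..<1+h} \<inter> E) = measure lborel {x. x + 1 \<in> {1..<1+h} \<inter> E}"
    by (rule measure_lborel_shift[symmetric]) simp
  also have "{x. x + 1 \<in> {1..<1+h} \<inter> E} = {0..<h} \<inter> E" using per by auto
  also have "measure lborel ({h..<1} \<inter> E) + measure lborel ({0..<h} \<inter> E)
     = measure lborel (({h..<1} \<inter> E) \<union> ({0..<h} \<inter> E))"
    by (rule measure_Un_fmeasurable_disjoint[symmetric])
       (use h in \<open>auto intro!: fmeasurable_lborel_bounded[of _ 0 2]\<close>)
  also have "({h..<1} \<inter> E) \<union> ({0..<h} \<inter> E) = {0..<1} \<inter> E" using h by auto
  finally show ?thesis .
qed

section \<open>Neighbourhoods of radius \<delta>/q around the points (\<gamma> + n)/q\<close>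

definition near_set :: "real \<Rightarrow> nat \<Rightarrow> real \<Rightarrow> real set" where
  "near_set \<gamma> q \<delta> = {x. nid (real q * x - \<gamma>) < \<delta>}"

lemma near_set_borel [measurable]: "near_set \<gamma> q \<delta> \<in> sets borel"
proof -
  have "{x \<in> space borel. nid (real q * x - \<gamma>) < \<delta>} \<in> sets borel" by measurable
  then show ?thesis by (simp add: near_set_def)
qed

lemma nid_eqI: "x - y = of_int n \<Longrightarrow> nid x = nid y"
  using nid_add_of_int[of y n] by (simp add: algebra_simps)

lemma near_set_periodic: "x + of_int n \<in> near_set \<gamma> q \<delta> \<longleftrightarrow> x \<in> near_set \<gamma> q \<delta>"
proof -
  have "nid (real q * (x + of_int n) - \<gamma>) = nid (real q * x - \<gamma>)"
    by (rule nid_eqI[of _ _ "int q * n"]) (simp add: algebra_simps)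
  then show ?thesis by (simp add: near_set_def)
qed

lemma near_set_shift_denom:
  assumes "0 < r"
  shows "x + real b / real r \<in> near_set \<gamma> r \<delta> \<longleftrightarrow> x \<in> near_set \<gamma> r \<delta>"
proof -
  have "nid (real r * (x + real b / real r) - \<gamma>) = nid (real r * x - \<gamma>)"
    by (rule nid_eqI[of _ _ "int b"]) (use assms in \<open>simp add: field_simps\<close>)
  then show ?thesis by (simp add: near_set_def)
qed

text \<open>Recentring at \<delta> instead of 0 puts the interval inside one period, so the distance
  becomes a condition on the fractional part without wrap-around.\<close>

lemma nid_diff_less_iff_frac:
  assumes "\<delta> \<le> 1/2"
  shows "nid (y - \<delta>) < \<delta> \<longleftrightarrow> 0 < frac y \<and> frac y < 2 * \<delta>"
proof
  assume "nid (y - \<delta>) < \<delta>"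
  then obtain n :: int where n: "\<bar>y - \<delta> - of_int n\<bar> < \<delta>" by (auto simp: nid_less_iff)
  then have "\<lfloor>y\<rfloor> = n" using assms by (intro floor_unique) linarith+
  then show "0 < frac y \<and> frac y < 2 * \<delta>" using n by (auto simp: frac_def abs_less_iff)
next
  assume "0 < frac y \<and> frac y < 2 * \<delta>"
  then have "\<bar>y - \<delta> - of_int \<lfloor>y\<rfloor>\<bar> < \<delta>" by (auto simp: frac_def abs_less_iff)
  then show "nid (y - \<delta>) < \<delta>" using nid_less_iff by blast
qed

lemma measure_near_set:
  assumes "0 < r" "0 \<le> \<delta>" "\<delta> \<le> 1/2"
  shows "measure lborel ({0..<1} \<inter> near_set \<gamma> r \<delta>) = 2 * \<delta>"
proof -
  \<comment> \<open>This shift turns \<open>r * x - \<gamma>\<close> into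
    \<open>r * x - \<delta>\<close> modulo 1, so the translated set consists of \<open>r\<close>
    disjoint intervals with left ends b/r, none of which crosses the ends of the unit
    interval.\<close>
  define h where "h = frac ((\<gamma> - \<delta>) / real r)"
  have h: "0 \<le> h" "h \<le> 1" unfolding h_def by (auto simp: frac_lt_1 less_imp_le)
  have eq: "{0..<1} \<inter> {x. x + h \<in> near_set \<gamma> r \<delta>}
      = (\<Union>b<r. {real b / real r<..<(real b + 2 * \<delta>) / real r})" (is "?L = ?R")
  proof -
    have nh: "nid (real r * (x + h) - \<gamma>) = nid (real r * x - \<delta>)" for x
      by (rule nid_eqI[of _ _ "- (int r * \<lfloor>(\<gamma> - \<delta>) / real r\<rfloor>)"])
         (use \<open>0 < r\<close> in \<open>simp add: h_def frac_def field_simps\<close>)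
    then have L: "x \<in> ?L \<longleftrightarrow> 0 \<le> x \<and> x < 1 \<and> 0 < frac (real r * x) \<and> frac (real r * x) < 2 * \<delta>" for x
      using nid_diff_less_iff_frac[OF assms(3), of "real r * x"] by (auto simp: near_set_def)
    show ?thesis
    proof (intro equalityI subsetI)
      fix x assume "x \<in> ?L"
      then have x: "0 \<le> x" "x < 1" "0 < frac (real r * x)" "frac (real r * x) < 2 * \<delta>" using L by auto
      define b where "b = nat \<lfloor>real r * x\<rfloor>"
      have b: "real b = of_int \<lfloor>real r * x\<rfloor>" using x by (simp add: b_def)
      have "real r * x < real r * 1" using x \<open>0 < r\<close> by (intro mult_strict_left_mono) auto
      then have "real b < real r" unfolding b by linarith
      then have "b < r" by simp
      moreover have "real b < real r * x" "real r * x < real b + 2 * \<delta>"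
        using x b by (auto simp: frac_def)
      then have "x \<in> {real b / real r<..<(real b + 2 * \<delta>) / real r}"
        using \<open>0 < r\<close> by (auto simp: field_simps)
      ultimately show "x \<in> ?R" by blast
    next
      fix x assume "x \<in> ?R"
      then obtain b where b: "b < r" "real b / real r < x" "x < (real b + 2 * \<delta>) / real r" by auto
      then have x: "real b < real r * x" "real r * x < real b + 2 * \<delta>"
        using \<open>0 < r\<close> by (auto simp: field_simps)
      then have fl: "\<lfloor>real r * x\<rfloor> = int b" using assms by (intro floor_unique) auto
      have "0 \<le> x" using b by (meson divide_nonneg_nonneg less_imp_le of_nat_0_le_iff order_trans)
      moreover have "real r * x < real r * 1" using x b(1) assms by linarith
      then have "x < 1" using \<open>0 < r\<close> by simp
      ultimately show "x \<in> ?L" unfolding L using x fl by (simp add: frac_def)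
    qed
  qed
  have "measure lborel ({0..<1} \<inter> near_set \<gamma> r \<delta>) = measure lborel ?L"
    by (rule measure_periodic_shift[symmetric])
       (use h near_set_periodic[of _ 1 \<gamma> r \<delta>] in simp_all)
  also have "\<dots> = (\<Sum>b<r. measure lborel {real b / real r<..<(real b + 2 * \<delta>) / real r})"
    unfolding eq
  proof (rule measure_finite_Union)
    show "disjoint_family_on (\<lambda>b. {real b / real r<..<(real b + 2 * \<delta>) / real r}) {..<r}"
    proof (unfold disjoint_family_on_def, intro ballI impI)
      fix a b :: nat assume "a \<noteq> b"
      have aux: "{real a / real r<..<(real a + 2 * \<delta>) / real r} \<inter> {real b / real r<..<(real b + 2 * \<delta>) / real r} = {}"
        if "a < b" for a b :: nat
      proof -
        have "real a + 2 * \<delta> \<le> real b" using that assms by linarith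
        then have "(real a + 2 * \<delta>) / real r \<le> real b / real r" by (intro divide_right_mono) auto
        then show ?thesis by auto
      qed
      show "{real a / real r<..<(real a + 2 * \<delta>) / real r} \<inter> {real b / real r<..<(real b + 2 * \<delta>) / real r} = {}"
        using aux[of a b] aux[of b a] \<open>a \<noteq> b\<close> by (cases "a < b") auto
    qed
    show "emeasure lborel {real b / real r<..<(real b + 2 * \<delta>) / real r} \<noteq> \<infinity>" for b
    proof -
      have "{real b / real r<..<(real b + 2 * \<delta>) / real r} \<in> fmeasurable lborel"
        by (rule fmeasurable_lborel_bounded[of _ "real b / real r" "(real b + 2 * \<delta>) / real r"]) auto
      then show ?thesis by (metis fmeasurableD2 infinity_ennreal_def)
    qed
  qed auto
  also have "\<dots> = (\<Sum>b<r. 2 * \<delta> / real r)"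
    using assms by (intro sum.cong) (auto simp: divide_right_mono add_divide_distrib)
  also have "\<dots> = 2 * \<delta>" using \<open>0 < r\<close> by simp
  finally show ?thesis .
qed

text \<open>With \<open>d\<close> the gcd, \<open>q = q' * d\<close> and \<open>r = r' * d\<close>,
  translation by b/r moves \<open>q * x\<close> by b q'/r', which modulo 1 has period
  \<open>r'\<close> in \<open>b\<close>. So \<open>d\<close> identical coprime rotations are
  counted, and each contributes one rounding error.\<close>

lemma card_shift_le:
  assumes "0 < r" "0 \<le> \<delta>"
  shows "real (card {b. b < r \<and> x + real b / real r \<in> near_set \<gamma> q \<delta>}) \<le> 2 * \<delta> * real r + real (gcd q r)"
proof -
  define d where "d = gcd q r"
  have "0 < d" using \<open>0 < r\<close> by (simp add: d_def)
  obtain q' r' where qr: "q = q' * d" "r = r' * d" "coprime q' r'"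
    using gcd_coprime_exists[of q r] \<open>0 < d\<close> unfolding d_def by auto
  have "0 < r'" using qr \<open>0 < r\<close> by simp
  let ?z = "real q * x - \<gamma>"
  let ?I = "{m. m < r' \<and> nid (?z + real m * (of_int (int q') / real r')) < \<delta>}"
  have "{b. b < r \<and> x + real b / real r \<in> near_set \<gamma> q \<delta>}
      = {b \<in> {0..<0 + d * r'}. x + real b / real r \<in> near_set \<gamma> q \<delta>}"
    by (auto simp: qr mult.commute)
  then have "card {b. b < r \<and> x + real b / real r \<in> near_set \<gamma> q \<delta>}
      = (\<Sum>i<d. card {m. m < r' \<and> x + real (0 + i * r' + m) / real r \<in> near_set \<gamma> q \<delta>})"
    by (simp only: card_split_blocks)
  also have "\<dots> = (\<Sum>i<d. card ?I)"
  proof (intro sum.cong refl arg_cong[where f = card] Collect_cong conj_cong)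
    fix i m
    have "nid (real q * (x + real (0 + i * r' + m) / real r) - \<gamma>)
        = nid (?z + real m * (of_int (int q') / real r'))"
      by (rule nid_eqI[of _ _ "int i * int q'"])
         (use \<open>0 < d\<close> \<open>0 < r'\<close> in \<open>simp add: qr field_simps\<close>)
    then show "(x + real (0 + i * r' + m) / real r \<in> near_set \<gamma> q \<delta>)
      = (nid (?z + real m * (of_int (int q') / real r')) < \<delta>)" by (simp add: near_set_def)
  qed
  also have "real (\<Sum>i<d. card ?I) = real d * real (card ?I)" by simp
  also have "\<dots> \<le> real d * (2 * \<delta> * real r' + 1)"
    using qr assms \<open>0 < r'\<close> by (intro mult_left_mono card_rational_rotation_le) auto
  also have "\<dots> = 2 * \<delta> * real r + real d" by (simp add: qr algebra_simps)
  finally show ?thesis by (simp add: d_def)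
qed

text \<open>Double counting: the sum of the measures is the integral of the number of sets
  containing a point, which is at most \<open>K\<close> on \<open>T\<close> and 0 elsewhere.\<close>

lemma sum_measure_le:
  fixes S :: "nat \<Rightarrow> real set"
  assumes S: "\<And>b. b < n \<Longrightarrow> S b \<in> fmeasurable lborel" "T \<in> fmeasurable lborel"
    and sub: "\<And>b. b < n \<Longrightarrow> S b \<subseteq> T"
    and K: "\<And>x. x \<in> T \<Longrightarrow> real (card {b. b < n \<and> x \<in> S b}) \<le> K"
  shows "(\<Sum>b<n. measure lborel (S b)) \<le> K * measure lborel T"
proof -
  have int: "integrable lborel (indicator A :: real \<Rightarrow> real)" if "A \<in> fmeasurable lborel" for A
    using that by (auto simp: fmeasurable_def)
  have "(\<Sum>b<n. measure lborel (S b)) = (\<Sum>b<n. \<integral>x. indicator (S b) x \<partial>lborel)"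
    by simp
  also have "\<dots> = (\<integral>x. (\<Sum>b<n. indicator (S b) x) \<partial>lborel)"
    by (subst Bochner_Integration.integral_sum) (auto intro!: int S)
  also have "\<dots> \<le> (\<integral>x. K * indicator T x \<partial>lborel)"
  proof (rule integral_mono)
    fix x
    have "(\<Sum>b<n. indicator (S b) x) = real (card {b. b < n \<and> x \<in> S b})"
      by (simp add: indicator_def Int_def lessThan_def)
    also have "\<dots> \<le> K * indicator T x"
    proof (cases "x \<in> T")
      case False
      then have "{b. b < n \<and> x \<in> S b} = {}" using sub by auto
      then show ?thesis using False by simp
    qed (use K in simp)
    finally show "(\<Sum>b<n. indicator (S b) x) \<le> K * indicator T x" .
  qed (auto intro!: int S)
  also have "\<dots> = K * measure lborel T" by simp
  finally show ?thesis .
qed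

(* Averaging the overlap over the translates by b/r, which preserve the second set, reduces its
   measure to a count of lattice points. *)
lemma measure_near_set_Int_le:
  assumes "0 < r" "0 \<le> \<delta>" "0 \<le> \<epsilon>" "\<epsilon> \<le> 1/2"
  shows "measure lborel ({0..<1} \<inter> (near_set \<gamma> q \<delta> \<inter> near_set \<gamma> r \<epsilon>))
     \<le> 4 * \<delta> * \<epsilon> + 2 * real (gcd q r) * (\<epsilon> / real r)"
proof -
  let ?E = "near_set \<gamma> q \<delta> \<inter> near_set \<gamma> r \<epsilon>"
  let ?T = "{0..<1} \<inter> near_set \<gamma> r \<epsilon>"
  let ?S = "\<lambda>b. {0..<1} \<inter> {x. x + real b / real r \<in> ?E}"
  have fm: "{0..<1} \<inter> A \<in> fmeasurable lborel" if "A \<in> sets borel" for A :: "real set"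
    using that by (auto intro!: fmeasurable_lborel_bounded[of _ 0 1])
  have "real r * measure lborel ({0..<1} \<inter> ?E) = (\<Sum>b<r. measure lborel ({0..<1} \<inter> ?E))" by simp
  also have "\<dots> = (\<Sum>b<r. measure lborel (?S b))"
  proof (intro sum.cong refl measure_periodic_shift[symmetric])
    show "x + 1 \<in> ?E \<longleftrightarrow> x \<in> ?E" for x
      using near_set_periodic[of x 1] by simp
  qed (use \<open>0 < r\<close> in auto)
  also have "\<dots> \<le> (2 * \<delta> * real r + real (gcd q r)) * measure lborel ?T"
  proof (rule sum_measure_le)
    show "?S b \<in> fmeasurable lborel" for b by (intro fm sets_borel_shift) simp
    show "?T \<in> fmeasurable lborel" by (intro fm) simp
    show "?S b \<subseteq> ?T" for b using near_set_shift_denom[OF \<open>0 < r\<close>] by auto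
    fix x
    have "card {b. b < r \<and> x \<in> ?S b} \<le> card {b. b < r \<and> x + real b / real r \<in> near_set \<gamma> q \<delta>}"
      by (intro card_mono) auto
    then show "real (card {b. b < r \<and> x \<in> ?S b}) \<le> 2 * \<delta> * real r + real (gcd q r)"
      using card_shift_le[of r \<delta> x \<gamma> q] assms by linarith
  qed
  also have "\<dots> = real r * (4 * \<delta> * \<epsilon> + 2 * real (gcd q r) * (\<epsilon> / real r))"
    using assms by (simp add: measure_near_set field_simps)
  finally show ?thesis using \<open>0 < r\<close> by simp
qed

text \<open>With \<open>d\<close> the gcd, \<open>q = q' * d\<close> and \<open>r = r' * d\<close>,
  the combination r' (q x - \<gamma>) - q' (r x - \<gamma>) does not involve x: it equals -(r' - q')
  \<gamma>. Hence a common point would force (r' - q') \<gamma> close to an integer.\<close>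

lemma near_set_Int_eq_empty:
  assumes "0 < r" "q \<le> r"
    and "(real r * \<delta> + real q * \<epsilon>) / real (gcd q r) \<le> nid (real ((r - q) div gcd q r) * \<gamma>)"
  shows "near_set \<gamma> q \<delta> \<inter> near_set \<gamma> r \<epsilon> = {}"
proof (rule ccontr)
  assume "near_set \<gamma> q \<delta> \<inter> near_set \<gamma> r \<epsilon> \<noteq> {}"
  then obtain x where x: "nid (real q * x - \<gamma>) < \<delta>" "nid (real r * x - \<gamma>) < \<epsilon>"
    by (auto simp: near_set_def)
  define d where "d = gcd q r"
  have "0 < d" using \<open>0 < r\<close> by (simp add: d_def)
  obtain q' r' where qr: "q = q' * d" "r = r' * d" "coprime q' r'"
    using gcd_coprime_exists[of q r] \<open>0 < d\<close> unfolding d_def by auto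
  have "0 < r'" using qr \<open>0 < r\<close> by simp
  have "q' \<le> r'" using \<open>q \<le> r\<close> qr \<open>0 < d\<close> by simp
  have rq: "(r - q) div d = r' - q'" using qr \<open>0 < d\<close> by (simp flip: diff_mult_distrib)
  have "real (r' - q') * \<gamma> = real q' * (real r * x - \<gamma>) * -1 + real r' * (real q * x - \<gamma>) + 2 * real (r' - q') * \<gamma>"
    using \<open>q' \<le> r'\<close> by (simp add: qr of_nat_diff algebra_simps)
  then have "- (real (r' - q') * \<gamma>) = real r' * (real q * x - \<gamma>) - real q' * (real r * x - \<gamma>)"
    by (simp add: algebra_simps)
  then have "nid (real (r' - q') * \<gamma>) = nid (real r' * (real q * x - \<gamma>) - real q' * (real r * x - \<gamma>))"
    using nid_minus[of "real (r' - q') * \<gamma>"] by simp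
  also have "\<dots> \<le> nid (real r' * (real q * x - \<gamma>)) + nid (real q' * (real r * x - \<gamma>))"
    by (rule nid_diff_le)
  also have "\<dots> \<le> real r' * nid (real q * x - \<gamma>) + real q' * nid (real r * x - \<gamma>)"
    by (intro add_mono nid_mult_nat_le)
  also have "\<dots> < real r' * \<delta> + real q' * \<epsilon>"
    using x \<open>0 < r'\<close> by (intro add_less_le_mono mult_strict_left_mono mult_left_mono) auto
  also have "\<dots> = (real r * \<delta> + real q * \<epsilon>) / real d"
    using \<open>0 < d\<close> by (simp add: qr field_simps)
  finally show False using assms(3) rq by (simp add: d_def)
qed

section \<open>A Borel-Cantelli lemma for nearly uncorrelated events\<close>

lemma square_of_sum:
  fixes f :: "nat \<Rightarrow> real"
  shows "(\<Sum>n<N. f n)^2 = (\<Sum>n<N. (f n)^2) + 2 * (\<Sum>n<N. \<Sum>m<n. f m * f n)"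
proof (induction N)
  case (Suc N)
  have "(\<Sum>n<Suc N. f n)^2 = (\<Sum>n<N. f n)^2 + 2 * (\<Sum>n<N. f n) * f N + (f N)^2"
    by (simp add: power2_sum)
  moreover have "(\<Sum>m<N. f m * f N) = (\<Sum>n<N. f n) * f N" by (simp add: sum_distrib_right)
  ultimately show ?case using Suc.IH by simp
qed simp

text \<open>The variance is of smaller order than the square of the mean, so Chebyshev's bound for
  the event of at most \<open>T\<close> hits tends to 0 as \<open>N\<close> grows. The union over
  \<open>T\<close> covers all points that are hit finitely often.\<close>

lemma (in prob_space) borel_cantelli_bounded_correlation:
  fixes A :: "nat \<Rightarrow> 'a set"
  assumes A [measurable]: "\<And>n. A n \<in> events"
    and div: "filterlim (\<lambda>N. \<Sum>n<N. prob (A n)) at_top sequentially"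
    and C: "\<And>N. (\<Sum>n<N. \<Sum>m<n. prob (A m \<inter> A n)) \<le> (\<Sum>n<N. \<Sum>m<n. prob (A m) * prob (A n)) + C"
  shows "AE x in M. infinite {n. x \<in> A n}"
proof -
  define S where "S N x = (\<Sum>n<N. indicator (A n) x :: real)" for N x
  define \<mu> where "\<mu> N = (\<Sum>n<N. prob (A n))" for N
  have S_meas [measurable]: "S N \<in> borel_measurable M" for N unfolding S_def by measurable
  have intA: "integrable M (indicator (A n) :: 'a \<Rightarrow> real)" for n
    by (simp add: integrable_indicator_iff less_top[symmetric])
  have intAA: "integrable M (\<lambda>x. indicator (A m) x * indicator (A n) x :: real)" for m n
    using integrable_mult_indicator[OF A intA] by simp
  have eS: "expectation (S N) = \<mu> N" for N
    unfolding S_def \<mu>_def by (subst Bochner_Integration.integral_sum) (auto intro!: intA sum.cong)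
  have S2: "(S N x)^2 = (\<Sum>n<N. indicator (A n) x) + 2 * (\<Sum>n<N. \<Sum>m<n. indicator (A m) x * indicator (A n) x)" for N x
    unfolding S_def square_of_sum by (simp add: indicator_def power2_eq_square)
  have intS: "integrable M (S N)" for N unfolding S_def by (auto intro!: intA)
  have intS2: "integrable M (\<lambda>x. (S N x)^2)" for N unfolding S2
    by (intro Bochner_Integration.integrable_add integrable_mult_right Bochner_Integration.integrable_sum intA intAA)
  have pAA: "expectation (\<lambda>x. indicator (A m) x * indicator (A n) x) = prob (A m \<inter> A n)" for m n
    by (simp flip: indicator_inter_arith)
  have intC: "integrable M (\<lambda>x. 2 * (\<Sum>n<N. \<Sum>m<n. indicator (A m) x * indicator (A n) x :: real))" for N
    by (intro integrable_mult_right Bochner_Integration.integrable_sum intAA)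
  have eS2: "expectation (\<lambda>x. (S N x)^2) = \<mu> N + 2 * (\<Sum>n<N. \<Sum>m<n. prob (A m \<inter> A n))" for N
  proof -
    have "expectation (\<lambda>x. (S N x)^2) = expectation (\<lambda>x. S N x + 2 * (\<Sum>n<N. \<Sum>m<n. indicator (A m) x * indicator (A n) x))"
      by (simp only: S2) (simp only: S_def)
    also have "\<dots> = expectation (S N) + 2 * expectation (\<lambda>x. \<Sum>n<N. \<Sum>m<n. indicator (A m) x * indicator (A n) x)"
      by (simp only: Bochner_Integration.integral_add[OF intS intC] integral_mult_right_zero)
    also have "expectation (\<lambda>x. \<Sum>n<N. \<Sum>m<n. indicator (A m) x * indicator (A n) x)
        = (\<Sum>n<N. \<Sum>m<n. prob (A m \<inter> A n))"
      by (simp only: Bochner_Integration.integral_sum Bochner_Integration.integrable_sum intAA pAA)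
    finally show ?thesis by (simp add: eS)
  qed
  have var: "variance (S N) \<le> \<mu> N + 2 * C" for N
  proof -
    have "variance (S N) = \<mu> N + 2 * (\<Sum>n<N. \<Sum>m<n. prob (A m \<inter> A n)) - (\<mu> N)^2"
      using variance_eq[OF intS intS2, of N] by (simp add: eS eS2)
    also have "\<dots> \<le> \<mu> N + 2 * (\<Sum>n<N. \<Sum>m<n. prob (A m) * prob (A n)) + 2 * C - (\<mu> N)^2"
      using C[of N] by simp
    \<comment> \<open>The square of the mean cancels the products over \<open>m < n\<close>; its
      diagonal, a sum of squares, is discarded with a favourable sign.\<close>
    also have "\<dots> \<le> \<mu> N + 2 * C"
      unfolding \<mu>_def square_of_sum by (simp add: sum_nonneg)
    finally show ?thesis .
  qed
  have \<mu>: "filterlim \<mu> at_top sequentially" using div by (simp add: \<mu>_def[abs_def])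
  define B where "B T = {x \<in> space M. \<forall>N. S N x \<le> real T}" for T :: nat
  have B_meas [measurable]: "B T \<in> events" for T unfolding B_def by measurable
  have "prob (B T) \<le> 0" for T
  proof (rule tendsto_lowerbound)
    have "((\<lambda>y::real. (y + 2 * C) / (y / 2)^2) \<longlongrightarrow> 0) at_top" by real_asymp
    then show "((\<lambda>N. (\<mu> N + 2 * C) / (\<mu> N / 2)^2) \<longlongrightarrow> 0) sequentially"
      by (rule filterlim_compose[OF _ \<mu>])
    \<comment> \<open>Once the mean is at least \<open>2 * T\<close>, having at most
      \<open>T\<close> hits is a deviation of at least half the mean. The 1 keeps the threshold in
      Chebyshev's inequality positive.\<close>
    have "eventually (\<lambda>N. \<mu> N \<ge> max 1 (2 * real T)) sequentially"
      using \<mu> unfolding filterlim_at_top by blast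
    then show "\<forall>\<^sub>F N in sequentially. prob (B T) \<le> (\<mu> N + 2 * C) / (\<mu> N / 2)^2"
    proof eventually_elim
      case (elim N)
      have "prob (B T) \<le> prob {x \<in> space M. \<bar>S N x - expectation (S N)\<bar> \<ge> \<mu> N / 2}"
      proof (intro finite_measure_mono subsetI)
        fix x assume "x \<in> B T"
        then have "x \<in> space M" "S N x \<le> real T" by (auto simp: B_def)
        then show "x \<in> {x \<in> space M. \<bar>S N x - expectation (S N)\<bar> \<ge> \<mu> N / 2}"
          using elim by (simp add: eS)
      qed measurable
      also have "\<dots> \<le> variance (S N) / (\<mu> N / 2)^2"
        by (rule Chebyshev_inequality) (use elim intS2 in auto)
      also have "\<dots> \<le> (\<mu> N + 2 * C) / (\<mu> N / 2)^2"
        by (intro divide_right_mono var) auto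
      finally show ?case .
    qed
  qed simp
  then have "B T \<in> null_sets M" for T
    by (intro null_setsI) (auto simp: emeasure_eq_measure measure_le_0_iff)
  then have "(\<Union>T. B T) \<in> null_sets M" by auto
  moreover have "{x \<in> space M. \<not> infinite {n. x \<in> A n}} \<subseteq> (\<Union>T. B T)"
  proof
    fix x assume x: "x \<in> {x \<in> space M. \<not> infinite {n. x \<in> A n}}"
    have "S N x \<le> real (card {n. x \<in> A n})" for N
    proof -
      have "S N x = real (card {n. n < N \<and> x \<in> A n})"
        by (simp add: S_def indicator_def Int_def lessThan_def)
      also have "\<dots> \<le> real (card {n. x \<in> A n})"
        using x by (intro of_nat_mono card_mono) auto
      finally show ?thesis .
    qed
    then show "x \<in> (\<Union>T. B T)" using x by (auto simp: B_def)
  qed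
  ultimately show ?thesis by (rule AE_I')
qed

section \<open>Diophantine rotations and Bohr sets\<close>

text \<open>A natural exponent lets \<open>root \<rho>\<close> invert the lower bound and keeps all
  scales powers of 2 with natural exponents.\<close>

locale diophantine_real =
  fixes \<beta> c :: real and \<rho> :: nat
  assumes c_pos: "0 < c" and rho_pos: "0 < \<rho>"
    and nid_ge: "\<And>n::nat. 0 < n \<Longrightarrow> c / real n ^ \<rho> \<le> nid (real n * \<beta>)"
begin

text \<open>The difference of two counted numbers has distance below \<open>2 * \<Delta>\<close> and
  so exceeds \<open>h\<close>. The same argument against 0 shows that each counted number itself
  exceeds \<open>h\<close>, which is why the bound has no additive constant; it would spoil the
  estimate when the main term is below 1.\<close>

lemma card_nid_less_le:
  assumes "0 < \<Delta>"
  shows "real (card {n. 0 < n \<and> n \<le> R \<and> nid (real n * \<beta>) < \<Delta>}) \<le> real R * root \<rho> (2 * \<Delta> / c)"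
proof -
  let ?X = "{n. 0 < n \<and> n \<le> R \<and> nid (real n * \<beta>) < \<Delta>}"
  define h where "h = root \<rho> (c / (2 * \<Delta>))"
  have h: "0 < h" using c_pos rho_pos assms by (simp add: h_def)
  have gap: "h < real n" if "0 < n" "nid (real n * \<beta>) < 2 * \<Delta>" for n
  proof -
    have "c / real n ^ \<rho> < 2 * \<Delta>" using nid_ge[OF that(1)] that(2) by linarith
    then have "c / (2 * \<Delta>) < real n ^ \<rho>" using that(1) assms by (simp add: field_simps)
    then have "h < root \<rho> (real n ^ \<rho>)" unfolding h_def using rho_pos by simp
    then show ?thesis using rho_pos by (simp add: real_root_power_cancel)
  qed
  have sep: "h < real y - real x" if "x \<in> ?X" "y \<in> ?X" "x < y" for x y
  proof -
    have "nid (real (y - x) * \<beta>) \<le> nid (real y * \<beta>) + nid (real x * \<beta>)"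
      using nid_diff_le[of "real y * \<beta>" "real x * \<beta>"] that by (simp add: of_nat_diff algebra_simps)
    then have "nid (real (y - x) * \<beta>) < 2 * \<Delta>" using that by auto
    then have "h < real (y - x)" using that by (intro gap) auto
    then show ?thesis using that by (simp add: of_nat_diff)
  qed
  have "inj_on (\<lambda>n. nat \<lfloor>real n / h\<rfloor>) ?X"
  proof (rule linorder_inj_onI)
    fix x y assume xy: "x < y" "x \<in> ?X" "y \<in> ?X"
    have "1 < real y / h - real x / h"
      using sep[OF xy(2,3,1)] h by (simp add: field_simps)
    moreover have "0 \<le> real x / h" using h by simp
    ultimately show "nat \<lfloor>real x / h\<rfloor> \<noteq> nat \<lfloor>real y / h\<rfloor>" by linarith
  qed auto
  moreover have "(\<lambda>n. nat \<lfloor>real n / h\<rfloor>) ` ?X \<subseteq> {1..nat \<lfloor>real R / h\<rfloor>}"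
  proof clarify
    fix n assume n: "0 < n" "n \<le> R" "nid (real n * \<beta>) < \<Delta>"
    have "h < real n" using n assms by (intro gap) auto
    then have "1 \<le> real n / h" using h by simp
    moreover have "real n / h \<le> real R / h" using n h by (intro divide_right_mono) auto
    ultimately show "nat \<lfloor>real n / h\<rfloor> \<in> {1..nat \<lfloor>real R / h\<rfloor>}"
      by (simp add: nat_mono floor_mono le_nat_iff)
  qed
  ultimately have "card ?X \<le> card {1..nat \<lfloor>real R / h\<rfloor>}"
    by (intro card_inj_on_le) auto
  then have "real (card ?X) \<le> real (nat \<lfloor>real R / h\<rfloor>)" by simp
  also have "\<dots> \<le> real R / h" using h by simp
  also have "\<dots> = real R * root \<rho> (2 * \<Delta> / c)"
    using rho_pos by (simp add: h_def real_root_divide)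
  finally show ?thesis .
qed

text \<open>If the Dirichlet denominator \<open>s\<close> were below 2^(4t), then
  \<open>s * d\<close> would be below 2^((w + 4) t), and the Diophantine bound would contradict the
  approximation within 2^(-v t). In \<open>v\<close> the 5 is this 4 plus 1 to absorb
  \<open>c\<close>. The lower bound 2^(4t) lets \<open>s\<close> orbit points resolve the finest
  level 2^(-3t) of the Bohr sets.\<close>

lemma dirichlet_denominator:
  assumes t: "1 \<le> c * 2 ^ t" and d: "0 < d" "d \<le> 2 ^ (w * t)" and v: "v = \<rho> * (w + 5)"
  obtains s :: nat and p :: int
  where "coprime p (int s)" "2 ^ (4 * t) \<le> s" "s \<le> 2 ^ (v * t)"
    "\<bar>real d * \<beta> - of_int p / real s\<bar> \<le> 1 / (real s)^2"
proof -
  have "0 < (2::nat) ^ (v * t)" by simp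
  then obtain h k :: int where hk: "coprime h k" "0 < k" "k \<le> int (2 ^ (v * t))"
    "\<bar>of_int k * (real d * \<beta>) - of_int h\<bar> < 1 / real (2 ^ (v * t))"
    by (rule Dirichlet_approx_coprime)
  define s where "s = nat k"
  have s: "0 < s" "k = int s" using hk by (auto simp: s_def)
  have sle: "s \<le> 2 ^ (v * t)" using hk(3) unfolding s by (simp only: of_nat_le_iff)
  have app: "\<bar>real s * (real d * \<beta>) - of_int h\<bar> < 1 / 2 ^ (v * t)" using hk(4) s by simp
  have "2 ^ (4 * t) \<le> s"
  proof (rule ccontr)
    assume "\<not> 2 ^ (4 * t) \<le> s"
    then have "s * d \<le> 2 ^ (4 * t) * 2 ^ (w * t)" using d by (intro mult_mono) auto
    then have "real (s * d) \<le> real (2 ^ (4 * t) * 2 ^ (w * t))" by (simp only: of_nat_le_iff)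
    then have "real (s * d) \<le> 2 ^ ((w + 4) * t)" by (simp add: power_add algebra_simps)
    then have "real (s * d) ^ \<rho> \<le> (2 ^ ((w + 4) * t)) ^ \<rho>" by (intro power_mono) auto
    also have "\<dots> = 2 ^ (\<rho> * (w + 4) * t)" by (simp add: power_mult[symmetric] algebra_simps)
    also have "\<dots> \<le> (c * 2 ^ t) * 2 ^ (\<rho> * (w + 4) * t)" using t by simp
    also have "\<dots> \<le> (c * 2 ^ (\<rho> * t)) * 2 ^ (\<rho> * (w + 4) * t)"
      using c_pos rho_pos by (intro mult_right_mono mult_left_mono power_increasing) auto
    also have "\<dots> = c * 2 ^ (v * t)" by (simp add: v power_add[symmetric] algebra_simps)
    finally have le: "real (s * d) ^ \<rho> \<le> c * 2 ^ (v * t)" .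
    have "c / real (s * d) ^ \<rho> \<le> nid (real (s * d) * \<beta>)" using s d by (intro nid_ge) auto
    also have "\<dots> \<le> \<bar>real s * (real d * \<beta>) - of_int h\<bar>"
      using nid_le[of "real (s * d) * \<beta>" h] by (simp add: mult.assoc)
    also note app
    finally have "c * 2 ^ (v * t) < real (s * d) ^ \<rho>" using s d by (simp add: field_simps)
    with le show False by simp
  qed
  moreover have "\<bar>real d * \<beta> - of_int h / real s\<bar> \<le> 1 / (real s)^2"
  proof -
    have "\<bar>real d * \<beta> - of_int h / real s\<bar> = \<bar>real s * (real d * \<beta>) - of_int h\<bar> / real s"
      using s by (simp add: field_simps abs_divide flip: abs_mult)
    also have "\<dots> \<le> (1 / 2 ^ (v * t)) / real s" using app s by (intro divide_right_mono) auto
    also have "\<dots> \<le> (1 / real s) / real s"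
    proof -
      have "real s \<le> 2 ^ (v * t)" using sle by (metis of_nat_le_iff of_nat_numeral of_nat_power)
      then show ?thesis using s by (intro divide_right_mono divide_left_mono) auto
    qed
    finally show ?thesis by (simp add: power2_eq_square)
  qed
  ultimately show ?thesis using that[of h s] hk(1) s sle by simp
qed

end

text \<open>Blocks of length \<open>s\<close> cover the interval, the last one possibly in excess;
  \<open>1 \<le> \<epsilon> * real s\<close> absorbs the error 3 of each block into
  \<open>5 * \<epsilon> * real s\<close>.\<close>

lemma card_rotation_interval_le:
  fixes \<alpha> z \<epsilon> :: real and p :: int
  assumes s: "coprime p (int s)" "0 < s" and \<epsilon>: "0 \<le> \<epsilon>" "1 \<le> \<epsilon> * real s"
    and \<alpha>: "\<bar>\<alpha> - of_int p / real s\<bar> \<le> 1 / (real s)^2"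
  shows "real (card {n \<in> {n0..<n0 + M}. nid (real n * \<alpha> - z) < \<epsilon>}) \<le> (real M / real s + 1) * (5 * \<epsilon> * real s)"
proof -
  define N where "N = M div s + 1"
  have "M \<le> N * s" unfolding N_def using s(2)
    by (metis Suc_eq_plus1 dividend_less_div_times less_imp_le mult_Suc add.commute)
  then have "card {n \<in> {n0..<n0 + M}. nid (real n * \<alpha> - z) < \<epsilon>} \<le> card {n \<in> {n0..<n0 + N * s}. nid (real n * \<alpha> - z) < \<epsilon>}"
    by (intro card_mono) auto
  also have "\<dots> = (\<Sum>i<N. card {m. m < s \<and> nid (real (n0 + i * s + m) * \<alpha> - z) < \<epsilon>})"
    by (rule card_split_blocks)
  finally have "real (card {n \<in> {n0..<n0 + M}. nid (real n * \<alpha> - z) < \<epsilon>})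
      \<le> (\<Sum>i<N. real (card {m. m < s \<and> nid (real (n0 + i * s + m) * \<alpha> - z) < \<epsilon>}))"
    by (simp flip: of_nat_sum)
  also have "\<dots> \<le> (\<Sum>i<N. 5 * \<epsilon> * real s)"
  proof (rule sum_mono)
    fix i
    have eq: "real (n0 + i * s + m) * \<alpha> - z = (real (n0 + i * s) * \<alpha> - z) + real m * \<alpha>" for m
      by (simp add: algebra_simps)
    have "real (card {m. m < s \<and> nid (real (n0 + i * s + m) * \<alpha> - z) < \<epsilon>}) \<le> 2 * \<epsilon> * real s + 3"
      using card_rotation_le[OF s \<epsilon>(1) \<alpha>, of "real (n0 + i * s) * \<alpha> - z"] unfolding eq .
    then show "real (card {m. m < s \<and> nid (real (n0 + i * s + m) * \<alpha> - z) < \<epsilon>}) \<le> 5 * \<epsilon> * real s"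
      using \<epsilon>(2) by linarith
  qed
  also have "\<dots> = real N * (5 * \<epsilon> * real s)" by simp
  also have "\<dots> \<le> (real M / real s + 1) * (5 * \<epsilon> * real s)"
  proof (rule mult_right_mono)
    show "real N \<le> real M / real s + 1" unfolding N_def using of_nat_div_le_of_nat[of M s] by simp
  qed (use \<epsilon> in auto)
  finally show ?thesis .
qed

text \<open>The complete blocks of length \<open>s\<close> fill at least half of the interval
  because \<open>s \<le> M\<close>, and the error 3 takes at most half of the expected visits in
  each block; together this loses the factor 4.\<close>

lemma card_rotation_interval_ge:
  fixes \<alpha> z a b :: real and p :: int
  assumes s: "coprime p (int s)" "0 < s" "s \<le> M" and ab: "0 \<le> a" "b \<le> 1/2" "3 \<le> (b - a) / 2 * real s"
    and \<alpha>: "\<bar>\<alpha> - of_int p / real s\<bar> \<le> 1 / (real s)^2"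
  shows "real M * (b - a) / 4 \<le> real (card {n \<in> {n0..<n0 + M}. a \<le> nid (real n * \<alpha> - z) \<and> nid (real n * \<alpha> - z) < b})"
proof -
  define N where "N = M div s"
  have N: "N * s \<le> M" "M < (N + 1) * s" "1 \<le> N" unfolding N_def using s
    by (auto simp: dividend_less_div_times add.commute Suc_le_eq div_greater_zero_iff)
  let ?P = "\<lambda>n. a \<le> nid (real n * \<alpha> - z) \<and> nid (real n * \<alpha> - z) < b"
  have "M \<le> 2 * (N * s)"
  proof -
    have "s \<le> N * s" using N(3) by simp
    moreover have "M < s + N * s" using N(2) by simp
    ultimately show ?thesis by linarith
  qed
  then have "real M \<le> real (2 * (N * s))" by (simp only: of_nat_le_iff)
  then have "real M * (b - a) \<le> (2 * (real N * real s)) * (b - a)"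
  proof (intro mult_right_mono)
    show "0 \<le> b - a"
    proof (rule ccontr)
      assume "\<not> 0 \<le> b - a"
      then have "(b - a) / 2 * real s \<le> 0" by (intro mult_nonpos_nonneg) auto
      then show False using ab(3) by linarith
    qed
  qed auto
  then have "real M * (b - a) / 4 \<le> (2 * (real N * real s)) * (b - a) / 4" by simp
  also have "\<dots> = (\<Sum>i<N. (b - a) / 2 * real s)" by simp
  also have "\<dots> \<le> (\<Sum>i<N. real (card {m. m < s \<and> ?P (n0 + i * s + m)}))"
  proof (rule sum_mono)
    fix i
    have eq: "real (n0 + i * s + m) * \<alpha> - z = (real (n0 + i * s) * \<alpha> - z) + real m * \<alpha>" for m
      by (simp add: algebra_simps)
    have "(b - a) * real s - 3 \<le> real (card {m. m < s \<and> ?P (n0 + i * s + m)})"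
      using card_rotation_ge[OF s(1,2) ab(1,2) \<alpha>, of "real (n0 + i * s) * \<alpha> - z"] unfolding eq .
    then show "(b - a) / 2 * real s \<le> real (card {m. m < s \<and> ?P (n0 + i * s + m)})"
      using ab(3) by argo
  qed
  also have "\<dots> = real (card {n \<in> {n0..<n0 + N * s}. ?P n})"
    by (simp only: card_split_blocks of_nat_sum)
  also have "\<dots> \<le> real (card {n \<in> {n0..<n0 + M}. ?P n})"
    using N by (intro of_nat_mono card_mono) auto
  finally show ?thesis .
qed

(* The window of levels from 2t to 3t is wide enough to contain a positive proportion of all k dyadic
   levels, while 3t < 2 * 2t makes the density 2^(-2t), squared over pairs, beat the radius 2^(3t)/2^k. *)
definition bohr :: "real \<Rightarrow> real \<Rightarrow> nat \<Rightarrow> nat \<Rightarrow> nat set" where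
  "bohr \<beta> z L k = {q \<in> {2 ^ k..<2 ^ (k + 1)}.
     1 / 2 ^ (3 * (k div L)) \<le> nid (real q * \<beta> - z) \<and> nid (real q * \<beta> - z) < 1 / 2 ^ (2 * (k div L))}"

context diophantine_real
begin

text \<open>With \<open>q = d * n\<close> the Bohr condition becomes a visit of the rotation by
  \<open>d * \<beta>\<close>. The bound on \<open>L\<close> yields \<open>d * s \<le> 2 ^ k\<close>,
  so the range of \<open>n\<close>, of length about 2^k / d, is long enough for a count proportional
  to its length.\<close>

lemma card_bohr_dvd_le:
  assumes t: "1 \<le> c * 2 ^ (k div L)" and d: "0 < d" "d \<le> 2 ^ (w * (k div L))"
    and L: "\<rho> * (w + 5) + w \<le> L"
  shows "real (card {q \<in> bohr \<beta> z L k. d dvd q}) \<le> 20 * 2 ^ k / (2 ^ (2 * (k div L)) * real d)"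
proof -
  define t where "t = k div L"
  define \<epsilon> where "\<epsilon> = 1 / (2::real) ^ (2 * t)"
  obtain s :: nat and p :: int where s: "coprime p (int s)" "2 ^ (4 * t) \<le> s" "s \<le> 2 ^ (\<rho> * (w + 5) * t)"
    "\<bar>real d * \<beta> - of_int p / real s\<bar> \<le> 1 / (real s)^2"
    using dirichlet_denominator[OF t d refl] unfolding t_def by blast
  have s0: "0 < s" using s(2) by (metis gr0I le_zero_eq power_not_zero zero_neq_numeral)
  have "(\<rho> * (w + 5) + w) * t \<le> L * t" using L by (intro mult_right_mono) auto
  also have "\<dots> \<le> k" unfolding t_def by simp
  finally have vk: "\<rho> * (w + 5) * t + w * t \<le> k" by (simp add: distrib_right)
  have "d * s \<le> 2 ^ (w * t) * 2 ^ (\<rho> * (w + 5) * t)"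
    using d(2) s(3) unfolding t_def by (intro mult_mono) auto
  also have "\<dots> = 2 ^ (\<rho> * (w + 5) * t + w * t)" by (simp add: power_add)
  also have "\<dots> \<le> 2 ^ k" using vk by (intro power_increasing) auto
  finally have ds: "d * s \<le> 2 ^ k" .
  then have ds': "real d * real s \<le> 2 ^ k"
    by (metis of_nat_le_iff of_nat_mult of_nat_numeral of_nat_power)
  have \<epsilon>s: "1 \<le> \<epsilon> * real s"
  proof -
    have "(2::nat) ^ (2 * t) \<le> 2 ^ (4 * t)" by (intro power_increasing) auto
    then have "2 ^ (2 * t) \<le> s" using s(2) by linarith
    then have "2 ^ (2 * t) \<le> real s" by (metis of_nat_le_iff of_nat_numeral of_nat_power)
    then show ?thesis by (simp add: \<epsilon>_def field_simps)
  qed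
  define n0 where "n0 = 2 ^ k div d"
  \<comment> \<open>Since 2^k < d (n0 + 1), every admissible \<open>n\<close> is below
    \<open>2 * n0 + 2\<close>; the 2 covers the rounding.\<close>
  let ?X = "{n \<in> {n0..<n0 + (n0 + 2)}. nid (real n * (real d * \<beta>) - z) < \<epsilon>}"
  have "{q \<in> bohr \<beta> z L k. d dvd q} \<subseteq> (\<lambda>n. d * n) ` ?X"
  proof
    fix q assume "q \<in> {q \<in> bohr \<beta> z L k. d dvd q}"
    moreover from this obtain n where "q = d * n" by (auto elim: dvdE)
    ultimately have n: "q = d * n" "2 ^ k \<le> d * n" "d * n < 2 ^ (k + 1)" "nid (real q * \<beta> - z) < \<epsilon>"
      by (auto simp: bohr_def \<epsilon>_def t_def)
    have "n0 \<le> n" unfolding n0_def using div_le_mono[OF n(2), of d] d(1) by simp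
    moreover have "n < n0 + (n0 + 2)"
    proof -
      have "2 ^ k < d * (n0 + 1)"
        unfolding n0_def using dividend_less_times_div[OF d(1), of "2 ^ k"] by simp
      then have "d * n < d * (n0 + (n0 + 2))" using n(3) by (simp add: algebra_simps)
      then show ?thesis by (simp only: mult_less_cancel1)
    qed
    moreover have "nid (real n * (real d * \<beta>) - z) < \<epsilon>" using n(4) by (simp add: n(1) algebra_simps)
    ultimately show "q \<in> (\<lambda>n. d * n) ` ?X" using n(1) by auto
  qed
  then have "card {q \<in> bohr \<beta> z L k. d dvd q} \<le> card ?X"
    by (intro surj_card_le) auto
  then have "real (card {q \<in> bohr \<beta> z L k. d dvd q}) \<le> real (card ?X)" by simp
  also have "\<dots> \<le> (real (n0 + 2) / real s + 1) * (5 * \<epsilon> * real s)"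
    using s s0 \<epsilon>s by (intro card_rotation_interval_le) (auto simp: \<epsilon>_def)
  \<comment> \<open>The 4 is 1 for \<open>n0 / s\<close>, 2 for \<open>2 / s\<close> and 1 for the
    last block, all compared with 2^k / (d s), which is at least 1.\<close>
  also have "\<dots> \<le> (4 * (2 ^ k / (real d * real s))) * (5 * \<epsilon> * real s)"
  proof (rule mult_right_mono)
    have "real n0 \<le> 2 ^ k / real d" unfolding n0_def using of_nat_div_le_of_nat[of "2 ^ k" d] by simp
    then have "real n0 / real s \<le> 2 ^ k / real d / real s" by (intro divide_right_mono) auto
    moreover have "1 \<le> 2 ^ k / (real d * real s)" using ds' d s0 by simp
    moreover have "2 / real s \<le> 2" using s0 by (simp add: field_simps)
    ultimately show "real (n0 + 2) / real s + 1 \<le> 4 * (2 ^ k / (real d * real s))"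
      by (simp add: add_divide_distrib)
  qed (simp add: \<epsilon>_def)
  also have "\<dots> = 20 * 2 ^ k / (2 ^ (2 * t) * real d)"
    using s0 d(1) by (simp add: \<epsilon>_def field_simps)
  finally show ?thesis by (simp add: t_def)
qed

lemma sum_inverse_bohr_ge:
  assumes t: "1 \<le> c * 2 ^ (k div L)" "4 \<le> k div L" and L: "\<rho> * 5 \<le> L"
  shows "real (k div L) * 2 ^ k / 8 \<le> (\<Sum>q\<in>bohr \<beta> z L k. 1 / nid (real q * \<beta> - z))"
proof -
  define t where "t = k div L"
  have t4: "4 \<le> t" using t(2) by (simp add: t_def)
  have dd: "(0::nat) < 1" "(1::nat) \<le> 2 ^ (0 * (k div L))" by auto
  obtain s :: nat and p :: int where s: "coprime p (int s)" "2 ^ (4 * t) \<le> s" "s \<le> 2 ^ (\<rho> * (0 + 5) * t)"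
    "\<bar>real 1 * \<beta> - of_int p / real s\<bar> \<le> 1 / (real s)^2"
    using dirichlet_denominator[OF t(1) dd refl] unfolding t_def by blast
  have s0: "0 < s" using s(2) by (metis gr0I le_zero_eq power_not_zero zero_neq_numeral)
  have s4: "2 ^ (4 * t) \<le> real s" using s(2) by (metis of_nat_le_iff of_nat_numeral of_nat_power)
  have "\<rho> * 5 * t \<le> L * t" using L by (intro mult_right_mono) auto
  also have "\<dots> \<le> k" unfolding t_def by simp
  finally have vk: "\<rho> * 5 * t \<le> k" .
  have "s \<le> 2 ^ (\<rho> * 5 * t)" using s(3) by simp
  also have "\<dots> \<le> 2 ^ k" using vk by (intro power_increasing) auto
  finally have sk: "s \<le> 2 ^ k" .
  define B where "B j = {q \<in> {2 ^ k..<2 ^ k + 2 ^ k}. 1 / 2 ^ (j + 1) \<le> nid (real q * \<beta> - z) \<and>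
     nid (real q * \<beta> - z) < 1 / 2 ^ j}" for j :: nat
  have finB: "finite (B j)" for j by (simp add: B_def)
  have Bj: "2 ^ k / 8 \<le> (\<Sum>q\<in>B j. 1 / nid (real q * \<beta> - z))" if j: "2 * t \<le> j" "j < 3 * t" for j
  proof -
    have "real (2 ^ k) * (1 / 2 ^ j - 1 / 2 ^ (j + 1)) / 4 \<le> real (card (B j))"
      unfolding B_def
    proof (rule card_rotation_interval_ge[OF s(1) s0 sk])
      have "(2::real) ^ 1 \<le> 2 ^ j" using j t4 by (intro power_increasing) auto
      then show "1 / 2 ^ j \<le> (1::real) / 2" by (simp add: field_simps)
      \<comment> \<open>Here \<open>4 \<le> t\<close> turns the gap between the level
        \<open>j < 3 * t\<close> and the denominator 2^(4t) into enough room for the error 3 of the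
        visit count.\<close>
      have "(16::real) * 2 ^ (j + 1) = 2 ^ (j + 5)" by (simp add: power_add)
      also have "\<dots> \<le> 2 ^ (4 * t + 1)" using j t4 by (intro power_increasing) auto
      also have "\<dots> \<le> 2 * real s" using s4 by simp
      finally show "3 \<le> (1 / 2 ^ j - 1 / 2 ^ (j + 1)) / 2 * real s" by (simp add: field_simps)
      show "\<bar>\<beta> - of_int p / real s\<bar> \<le> 1 / (real s)^2" using s(4) by simp
    qed simp
    then have "2 ^ k / 8 \<le> real (card (B j)) * 2 ^ j" by (simp add: field_simps)
    also have "\<dots> = (\<Sum>q\<in>B j. 2 ^ j)" by simp
    also have "\<dots> \<le> (\<Sum>q\<in>B j. 1 / nid (real q * \<beta> - z))"
    proof (rule sum_mono)
      fix q assume "q \<in> B j"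
      then have q: "1 / 2 ^ (j + 1) \<le> nid (real q * \<beta> - z)" "nid (real q * \<beta> - z) < 1 / 2 ^ j"
        by (auto simp: B_def)
      have "0 < 1 / (2::real) ^ (j + 1)" by simp
      then have "0 < nid (real q * \<beta> - z)" using q(1) by linarith
      then show "2 ^ j \<le> 1 / nid (real q * \<beta> - z)" using q(2) by (simp add: field_simps)
    qed
    finally show ?thesis .
  qed
  have disj: "B i \<inter> B j = {}" if "i < j" for i j
  proof -
    have "(2::real) ^ (i + 1) \<le> 2 ^ j" using that by (intro power_increasing) auto
    then have "1 / (2::real) ^ j \<le> 1 / 2 ^ (i + 1)" by (intro divide_left_mono) auto
    then show ?thesis by (auto simp: B_def)
  qed
  have "real t * 2 ^ k / 8 = (\<Sum>j\<in>{2 * t..<3 * t}. 2 ^ k / 8)" by simp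
  also have "\<dots> \<le> (\<Sum>j\<in>{2 * t..<3 * t}. \<Sum>q\<in>B j. 1 / nid (real q * \<beta> - z))"
    by (intro sum_mono Bj) auto
  also have "\<dots> = (\<Sum>q\<in>(\<Union>j\<in>{2 * t..<3 * t}. B j). 1 / nid (real q * \<beta> - z))"
    by (rule sum.UNION_disjoint[symmetric]) (use finB disj in \<open>auto, metis IntI empty_iff linorder_neqE_nat\<close>)
  also have "\<dots> \<le> (\<Sum>q\<in>bohr \<beta> z L k. 1 / nid (real q * \<beta> - z))"
  proof (rule sum_mono2)
    show "finite (bohr \<beta> z L k)" by (simp add: bohr_def)
    show "(\<Union>j\<in>{2 * t..<3 * t}. B j) \<subseteq> bohr \<beta> z L k"
    proof
      fix q assume "q \<in> (\<Union>j\<in>{2 * t..<3 * t}. B j)"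
      then obtain j where j: "2 * t \<le> j" "j < 3 * t" "q \<in> B j" by auto
      have "(2::real) ^ (j + 1) \<le> 2 ^ (3 * t)" "(2::real) ^ (2 * t) \<le> 2 ^ j"
        using j by (auto intro!: power_increasing simp del: power_Suc)
      then have "1 / (2::real) ^ (3 * t) \<le> 1 / 2 ^ (j + 1)" "1 / (2::real) ^ j \<le> 1 / 2 ^ (2 * t)"
        by (auto intro!: divide_left_mono simp del: power_Suc)
      then show "q \<in> bohr \<beta> z L k" using j(3) unfolding bohr_def B_def t_def by auto
    qed
  qed auto
  finally show ?thesis by (simp add: t_def)
qed

end

section \<open>Summation of the overlaps\<close>

lemma div_add_le:
  fixes a b n :: nat
  shows "0 < n \<Longrightarrow> (a + b) div n \<le> a div n + b div n + 1"
proof -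
  assume "0 < n"
  then have "a mod n + b mod n < 2 * n"
    by (metis add_strict_mono mod_less_divisor mult_2)
  then have "(a mod n + b mod n) div n < 2" using \<open>0 < n\<close> by (intro less_mult_imp_div_less) auto
  then show ?thesis by (subst div_add1_eq) simp
qed

lemma sum_inverse_le_log: "(\<Sum>d\<in>{1..2 ^ n}. 1 / real d) \<le> real n + 1"
proof (induction n)
  case (Suc n)
  have "{1..2 ^ Suc n} = {1..2 ^ n} \<union> {2 ^ n + 1..2 ^ Suc n::nat}" by auto
  then have "(\<Sum>d\<in>{1..2 ^ Suc n}. 1 / real d) = (\<Sum>d\<in>{1..2 ^ n}. 1 / real d) + (\<Sum>d\<in>{2 ^ n + 1..2 ^ Suc n}. 1 / real d)"
    by (simp only:) (rule sum.union_disjoint; auto)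
  also have "(\<Sum>d\<in>{2 ^ n + 1..2 ^ Suc n}. 1 / real d) \<le> (\<Sum>d\<in>{2 ^ n + 1..2 ^ Suc n::nat}. 1 / 2 ^ n)"
  proof (rule sum_mono)
    fix d :: nat assume "d \<in> {2 ^ n + 1..2 ^ Suc n}"
    then have "2 ^ n \<le> d" by simp
    then have "2 ^ n \<le> real d" by (metis of_nat_le_iff of_nat_numeral of_nat_power)
    moreover have "(0::real) < 2 ^ n" by simp
    ultimately show "1 / real d \<le> 1 / 2 ^ n" by (intro divide_left_mono mult_pos_pos) linarith+
  qed
  also have "\<dots> = 1" by simp
  finally show ?case using Suc.IH by simp
qed simp

(* A gcd counts as large above 2^(8 * rho * t): the spacing of the resonances of gamma then saves
   about 2^(8t), which is more than the factors 2^(3t) lost through the radii. *)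
locale thin_radii = B: diophantine_real \<beta> c \<rho> + G: diophantine_real \<gamma> c \<rho>
  for \<beta> \<gamma> c :: real and \<rho> :: nat +
  fixes z :: real and L K0 :: nat and \<delta> :: "nat \<Rightarrow> real"
  assumes rho_ge: "2 \<le> \<rho>" and L_ge: "\<rho> * (8 * \<rho> + 5) + 8 * \<rho> + 8 \<le> L"
    and K0: "1 \<le> c * 2 ^ (K0 div L)"
    and radius_nonneg: "\<And>q. 0 \<le> \<delta> q" and radius_le_half: "\<And>q. \<delta> q \<le> 1/2"
    and radius_le: "\<And>k q. K0 \<le> k \<Longrightarrow> q \<in> bohr \<beta> z L k \<Longrightarrow> \<delta> q \<le> 2 ^ (3 * (k div L)) / 2 ^ k"
    and radius_supp: "\<And>q. \<delta> q \<noteq> 0 \<Longrightarrow> \<exists>k\<ge>K0. q \<in> bohr \<beta> z L k"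
begin

text \<open>The subtracted term is the product of the two measures. Clipping at 0 allows sums of
  excesses to be extended to larger index sets.\<close>

definition excess :: "nat \<Rightarrow> nat \<Rightarrow> real" where
  "excess q r = max 0 (measure lborel ({0..<1} \<inter> (near_set \<gamma> q (\<delta> q) \<inter> near_set \<gamma> r (\<delta> r))) - 4 * \<delta> q * \<delta> r)"

definition block_pairs :: "nat \<Rightarrow> nat \<Rightarrow> (nat \<times> nat) set" where
  "block_pairs k l = {(q, r). q \<in> bohr \<beta> z L k \<and> r \<in> bohr \<beta> z L l \<and> q < r}"

lemma finite_bohr [simp]: "finite (bohr \<beta> z L k)"
  by (simp add: bohr_def)

lemma finite_block_pairs [simp]: "finite (block_pairs k l)"
  by (rule finite_subset[of _ "bohr \<beta> z L k \<times> bohr \<beta> z L l"]) (auto simp: block_pairs_def)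

lemma block_const: "K0 \<le> k \<Longrightarrow> 1 \<le> c * 2 ^ (k div L)"
proof -
  assume "K0 \<le> k"
  then have "(2::real) ^ (K0 div L) \<le> 2 ^ (k div L)" by (intro power_increasing div_le_mono) auto
  then have "c * 2 ^ (K0 div L) \<le> c * 2 ^ (k div L)" using B.c_pos by (intro mult_left_mono) auto
  then show ?thesis using K0 by linarith
qed

lemma excess_zero: "\<delta> q = 0 \<or> \<delta> r = 0 \<Longrightarrow> excess q r = 0"
proof -
  have "near_set \<gamma> n 0 = {}" for n by (simp add: near_set_def not_less)
  then show "\<delta> q = 0 \<or> \<delta> r = 0 \<Longrightarrow> excess q r = 0" by (auto simp: excess_def)
qed

text \<open>The gcd is dominated by a sum of \<open>d\<close> over common divisors, which replaces
  an exact gcd by divisibility conditions that can be counted for each \<open>d\<close> separately.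
  Either the gcd is small, or (r - q)/gcd is a resonance of \<gamma>, or the neighbourhoods are
  disjoint and the excess vanishes.\<close>

lemma excess_le:
  assumes k: "K0 \<le> k" "k \<le> l" and qr: "(q, r) \<in> block_pairs k l"
  defines "t \<equiv> k div L" and "u \<equiv> l div L"
  defines "\<Delta> \<equiv> 2 ^ (l - k + 3 * t + 5) / 2 ^ (8 * \<rho> * t)"
  shows "excess q r \<le> 2 * (2 ^ (3 * u) / (2 ^ l * 2 ^ l)) *
     ((\<Sum>d\<in>{1..2 ^ (8 * \<rho> * t)}. real d * of_bool (d dvd q \<and> d dvd r)) +
      (\<Sum>d\<in>{1..2 ^ (k + 1)}. real d * of_bool (d dvd q \<and> d dvd r \<and> nid (real ((r - q) div d) * \<gamma>) < \<Delta>)))"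
    (is "_ \<le> 2 * ?e * (?S1 + ?S2)")
proof -
  have q: "q \<in> bohr \<beta> z L k" "2 ^ k \<le> q" "q < 2 ^ (k + 1)" and r: "r \<in> bohr \<beta> z L l" "2 ^ l \<le> r" "r < 2 ^ (l + 1)"
    and "q < r" using qr by (auto simp: block_pairs_def bohr_def)
  have q': "2 ^ k \<le> real q" "real q \<le> 2 ^ (k + 1)" and r': "2 ^ l \<le> real r" "real r \<le> 2 ^ (l + 1)"
    using q(2,3) r(2,3) by (metis less_imp_le of_nat_le_iff of_nat_numeral of_nat_power)+
  have "0 < r" using \<open>q < r\<close> by simp
  have "0 < q" using q(2) by (metis gr0I le_zero_eq power_not_zero zero_neq_numeral)
  have dq: "\<delta> q \<le> 2 ^ (3 * t) / 2 ^ k" unfolding t_def using k q by (intro radius_le) auto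
  have dr: "\<delta> r \<le> 2 ^ (3 * u) / 2 ^ l" unfolding u_def using k r by (intro radius_le) auto
  define d where "d = gcd q r"
  have d: "0 < d" "d dvd q" "d dvd r" using \<open>0 < r\<close> by (auto simp: d_def)
  have "d \<le> q" using d \<open>0 < q\<close> by (auto dest: dvd_imp_le)
  then have d_le: "d \<le> 2 ^ (k + 1)" using q by linarith
  have S_nonneg: "0 \<le> ?S1" "0 \<le> ?S2" by (auto intro!: sum_nonneg)
  have ex: "excess q r \<le> 2 * ?e * real d"
  proof -
    have "measure lborel ({0..<1} \<inter> (near_set \<gamma> q (\<delta> q) \<inter> near_set \<gamma> r (\<delta> r)))
      \<le> 4 * \<delta> q * \<delta> r + 2 * real d * (\<delta> r / real r)"
      unfolding d_def using \<open>0 < r\<close> by (intro measure_near_set_Int_le radius_nonneg radius_le_half)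
    moreover have "\<delta> r / real r \<le> ?e"
    proof -
      have "\<delta> r / real r \<le> (2 ^ (3 * u) / 2 ^ l) / 2 ^ l"
        using dr r' radius_nonneg[of r] by (intro frac_le) auto
      then show ?thesis by simp
    qed
    then have "2 * real d * (\<delta> r / real r) \<le> 2 * real d * ?e" by (intro mult_left_mono) auto
    ultimately have "measure lborel ({0..<1} \<inter> (near_set \<gamma> q (\<delta> q) \<inter> near_set \<gamma> r (\<delta> r)))
      - 4 * \<delta> q * \<delta> r \<le> 2 * ?e * real d" by (simp add: algebra_simps)
    moreover have "0 \<le> 2 * ?e * real d" by simp
    ultimately show ?thesis unfolding excess_def by simp
  qed
  consider (small) "d \<le> 2 ^ (8 * \<rho> * t)"
    | (hit) "nid (real ((r - q) div d) * \<gamma>) < \<Delta>"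
    | (miss) "2 ^ (8 * \<rho> * t) < d" "\<Delta> \<le> nid (real ((r - q) div d) * \<gamma>)" by linarith
  then show ?thesis
  proof cases
    case small
    have "real d * of_bool (d dvd q \<and> d dvd r) \<le> ?S1"
      by (rule member_le_sum[of d _ "\<lambda>d. real d * of_bool (d dvd q \<and> d dvd r)"]) (use small d in auto)
    then have "real d \<le> ?S1 + ?S2" using d S_nonneg by simp
    then have "2 * ?e * real d \<le> 2 * ?e * (?S1 + ?S2)" by (intro mult_left_mono) auto
    then show ?thesis using ex by linarith
  next
    case hit
    have "real d * of_bool (d dvd q \<and> d dvd r \<and> nid (real ((r - q) div d) * \<gamma>) < \<Delta>) \<le> ?S2"
      by (rule member_le_sum[of d _ "\<lambda>d. real d * of_bool (d dvd q \<and> d dvd r \<and> nid (real ((r - q) div d) * \<gamma>) < \<Delta>)"])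
         (use d d_le in auto)
    then have "real d \<le> ?S1 + ?S2" using d hit S_nonneg by simp
    then have "2 * ?e * real d \<le> 2 * ?e * (?S1 + ?S2)" by (intro mult_left_mono) auto
    then show ?thesis using ex by linarith
  next
    case miss
    have d2: "2 ^ (8 * \<rho> * t) \<le> real d"
      using miss(1) by (metis less_imp_le of_nat_le_iff of_nat_numeral of_nat_power)
    have "real r * \<delta> q \<le> 2 ^ (l + 1) * (2 ^ (3 * t) / 2 ^ k)"
      using r' dq radius_nonneg by (intro mult_mono) auto
    also have "\<dots> = 2 * 2 ^ (l - k + 3 * t)"
      using k by (simp add: power_add power_diff)
    finally have 1: "real r * \<delta> q \<le> 2 * 2 ^ (l - k + 3 * t)" .
    have "real q * \<delta> r \<le> 2 ^ (k + 1) * (2 ^ (3 * u) / 2 ^ l)"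
      using q' dr radius_nonneg by (intro mult_mono) auto
    also have "\<dots> = 2 * (2 ^ (k + 3 * u) / 2 ^ l)" by (simp add: power_add)
    \<comment> \<open>Passing from block \<open>k\<close> to block \<open>l\<close> raises the level
      by at most (l - k)/3 + 1, so the larger radius factor 2^(3u) costs at most 2^(l - k +
      3).\<close>
    also have "2 ^ (k + 3 * u) / 2 ^ l \<le> (2::real) ^ (l - k + 3 * t + 3)"
    proof -
      have "8 \<le> L" using L_ge by simp
      have "u \<le> t + (l - k) div L + 1"
      proof -
        have "u = ((l - k) + k) div L" using k by (simp add: u_def)
        also have "\<dots> \<le> (l - k) div L + k div L + 1" using \<open>8 \<le> L\<close> by (intro div_add_le) auto
        finally show ?thesis by (simp add: t_def)
      qed
      moreover have "(l - k) div L \<le> (l - k) div 3" using \<open>8 \<le> L\<close> by (intro div_le_mono2) auto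
      ultimately have "u \<le> t + (l - k) div 3 + 1" by linarith
      then have "k + 3 * u \<le> l - k + 3 * t + 3 + l" using k by linarith
      then have "(2::real) ^ (k + 3 * u) \<le> 2 ^ (l - k + 3 * t + 3 + l)" by (intro power_increasing) auto
      then show ?thesis by (simp add: power_add field_simps)
    qed
    finally have 2: "real q * \<delta> r \<le> 16 * 2 ^ (l - k + 3 * t)" by (simp add: power_add)
    have "0 \<le> (2::real) ^ (l - k + 3 * t)" by simp
    \<comment> \<open>The sum 2 + 16 is rounded up to 32, whence the exponent 5 in \<Delta>.\<close>
    then have "real r * \<delta> q + real q * \<delta> r \<le> 32 * 2 ^ (l - k + 3 * t)" using 1 2 by linarith
    also have "\<dots> = 2 ^ (l - k + 3 * t + 5)" by (simp add: power_add)
    finally have "(real r * \<delta> q + real q * \<delta> r) / real d \<le> \<Delta>"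
      unfolding \<Delta>_def using d2 radius_nonneg by (intro frac_le) auto
    then have "near_set \<gamma> q (\<delta> q) \<inter> near_set \<gamma> r (\<delta> r) = {}"
      using miss(2) \<open>0 < r\<close> \<open>q < r\<close> by (intro near_set_Int_eq_empty) (auto simp: d_def)
    then have "excess q r = 0" using radius_nonneg by (simp add: excess_def)
    then show ?thesis using S_nonneg by simp
  qed
qed

section \<open>Excess summed over a pair of dyadic blocks\<close>

lemma sum_of_bool_eq_card: "finite A \<Longrightarrow> (\<Sum>x\<in>A. of_bool (P x)) = real (card {x \<in> A. P x})"
  by (simp add: of_bool_def Int_def flip: sum.inter_filter)

text \<open>For fixed \<open>d\<close> both coordinates run through multiples of \<open>d\<close> in
  a Bohr set, so 1/d^2 against the weight \<open>d\<close> leaves a harmonic sum. The range of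
  \<open>d\<close> is set by the smaller block and is admissible for the larger one because
  \<open>t \<le> u\<close>; 400 is the square of 20.\<close>

lemma sum_common_divisors_le:
  assumes k: "K0 \<le> k" "k \<le> l"
  defines "t \<equiv> k div L" and "u \<equiv> l div L"
  shows "(\<Sum>(q, r)\<in>block_pairs k l. \<Sum>d\<in>{1..2 ^ (8 * \<rho> * t)}. real d * of_bool (d dvd q \<and> d dvd r))
     \<le> 400 * (2 ^ k / 2 ^ (2 * t)) * (2 ^ l / 2 ^ (2 * u)) * (real (8 * \<rho> * t) + 1)"
proof -
  have tu: "t \<le> u" unfolding t_def u_def using k by (intro div_le_mono)
  have "(\<Sum>(q, r)\<in>block_pairs k l. \<Sum>d\<in>{1..2 ^ (8 * \<rho> * t)}. real d * of_bool (d dvd q \<and> d dvd r))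
      = (\<Sum>d\<in>{1..2 ^ (8 * \<rho> * t)}. real d * (\<Sum>p\<in>block_pairs k l. of_bool (d dvd fst p \<and> d dvd snd p)))"
    unfolding case_prod_unfold sum_distrib_left by (rule sum.swap)
  also have "\<dots> \<le> (\<Sum>d\<in>{1..2 ^ (8 * \<rho> * t)}. (400 * (2 ^ k / 2 ^ (2 * t)) * (2 ^ l / 2 ^ (2 * u))) * (1 / real d))"
  proof (rule sum_mono)
    fix d :: nat assume "d \<in> {1..2 ^ (8 * \<rho> * t)}"
    then have d: "0 < d" "d \<le> 2 ^ (8 * \<rho> * (k div L))" by (auto simp: t_def)
    have "8 * \<rho> * (k div L) \<le> 8 * \<rho> * (l div L)" using tu by (simp add: t_def u_def)
    then have "(2::nat) ^ (8 * \<rho> * (k div L)) \<le> 2 ^ (8 * \<rho> * (l div L))" by (intro power_increasing) auto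
    then have d': "d \<le> 2 ^ (8 * \<rho> * (l div L))" using d by linarith
    have L': "\<rho> * (8 * \<rho> + 5) + 8 * \<rho> \<le> L" using L_ge by simp
    have "(\<Sum>p\<in>block_pairs k l. of_bool (d dvd fst p \<and> d dvd snd p)) = real (card {p \<in> block_pairs k l. d dvd fst p \<and> d dvd snd p})"
      by (rule sum_of_bool_eq_card) simp
    also have "\<dots> \<le> real (card ({q \<in> bohr \<beta> z L k. d dvd q} \<times> {r \<in> bohr \<beta> z L l. d dvd r}))"
      by (intro of_nat_mono card_mono) (auto simp: block_pairs_def)
    also have "\<dots> = real (card {q \<in> bohr \<beta> z L k. d dvd q}) * real (card {r \<in> bohr \<beta> z L l. d dvd r})"
      by (simp add: card_cartesian_product)
    also have "\<dots> \<le> (20 * 2 ^ k / (2 ^ (2 * t) * real d)) * (20 * 2 ^ l / (2 ^ (2 * u) * real d))"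
      unfolding t_def u_def using k
      by (intro mult_mono B.card_bohr_dvd_le[OF block_const d(1) d(2) L'] B.card_bohr_dvd_le[OF block_const d(1) d' L']) auto
    finally have "real d * (\<Sum>p\<in>block_pairs k l. of_bool (d dvd fst p \<and> d dvd snd p))
      \<le> real d * ((20 * 2 ^ k / (2 ^ (2 * t) * real d)) * (20 * 2 ^ l / (2 ^ (2 * u) * real d)))"
      by (intro mult_left_mono) auto
    also have "\<dots> = (400 * (2 ^ k / 2 ^ (2 * t)) * (2 ^ l / 2 ^ (2 * u))) * (1 / real d)"
      using d(1) by (simp add: field_simps)
    finally show "real d * (\<Sum>p\<in>block_pairs k l. of_bool (d dvd fst p \<and> d dvd snd p))
      \<le> (400 * (2 ^ k / 2 ^ (2 * t)) * (2 ^ l / 2 ^ (2 * u))) * (1 / real d)" .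
  qed
  also have "\<dots> = (400 * (2 ^ k / 2 ^ (2 * t)) * (2 ^ l / 2 ^ (2 * u))) * (\<Sum>d\<in>{1..2 ^ (8 * \<rho> * t)}. 1 / real d)"
    by (simp only: sum_distrib_left)
  also have "\<dots> \<le> (400 * (2 ^ k / 2 ^ (2 * t)) * (2 ^ l / 2 ^ (2 * u))) * (real (8 * \<rho> * t) + 1)"
    by (intro mult_left_mono sum_inverse_le_log) auto
  finally show ?thesis .
qed

text \<open>The Bohr condition is discarded and a pair is encoded by (q/d, (r - q)/d). The first
  entry has at most 2^(k+1)/d values and the second is a resonance of \<gamma> up to 2^(l+1)/d, so
  again 1/d^2 meets the weight \<open>d\<close>.\<close>

lemma sum_resonant_divisors_le:
  assumes "0 < \<Delta>"
  shows "(\<Sum>(q, r)\<in>block_pairs k l. \<Sum>d\<in>{1..2 ^ (k + 1)}.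
       real d * of_bool (d dvd q \<and> d dvd r \<and> nid (real ((r - q) div d) * \<gamma>) < \<Delta>))
     \<le> 4 * 2 ^ k * 2 ^ l * root \<rho> (2 * \<Delta> / c) * (real (k + 1) + 1)"
proof -
  define R where "R = root \<rho> (2 * \<Delta> / c)"
  have R: "0 \<le> R" unfolding R_def using assms B.c_pos B.rho_pos by simp
  let ?P = "\<lambda>d p. d dvd fst p \<and> d dvd snd p \<and> nid (real ((snd p - fst p) div d) * \<gamma>) < \<Delta>"
  have "(\<Sum>(q, r)\<in>block_pairs k l. \<Sum>d\<in>{1..2 ^ (k + 1)}.
       real d * of_bool (d dvd q \<and> d dvd r \<and> nid (real ((r - q) div d) * \<gamma>) < \<Delta>))
      = (\<Sum>d\<in>{1..2 ^ (k + 1)}. real d * (\<Sum>p\<in>block_pairs k l. of_bool (?P d p)))"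
    unfolding case_prod_unfold sum_distrib_left by (rule sum.swap)
  also have "\<dots> \<le> (\<Sum>d\<in>{1..2 ^ (k + 1)}. (4 * 2 ^ k * 2 ^ l * R) * (1 / real d))"
  proof (rule sum_mono)
    fix d :: nat assume "d \<in> {1..2 ^ (k + 1)}"
    then have d: "0 < d" by auto
    let ?N = "{n. 0 < n \<and> n \<le> 2 ^ (l + 1) div d \<and> nid (real n * \<gamma>) < \<Delta>}"
    have "card {p \<in> block_pairs k l. ?P d p} \<le> card ({1..2 ^ (k + 1) div d} \<times> ?N)"
    proof (rule card_inj_on_le)
      let ?f = "\<lambda>p. (fst p div d, (snd p - fst p) div d)"
      show "inj_on ?f {p \<in> block_pairs k l. ?P d p}"
      proof (rule inj_onI)
        fix p p' assume p: "p \<in> {p \<in> block_pairs k l. ?P d p}" "p' \<in> {p \<in> block_pairs k l. ?P d p}" "?f p = ?f p'"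
        have rec: "fst p = d * fst (?f p)" "snd p = d * fst (?f p) + d * snd (?f p)"
          if "p \<in> {p \<in> block_pairs k l. ?P d p}" for p
          using that d by (auto simp: block_pairs_def dvd_diff_nat)
        show "p = p'" using rec[OF p(1)] rec[OF p(2)] p(3) by (metis prod_eq_iff)
      qed
      show "?f ` {p \<in> block_pairs k l. ?P d p} \<subseteq> {1..2 ^ (k + 1) div d} \<times> ?N"
      proof (rule image_subsetI)
        fix p assume p: "p \<in> {p \<in> block_pairs k l. ?P d p}"
        obtain q r where pqr: "p = (q, r)" by (cases p)
        have qr: "(q, r) \<in> block_pairs k l" "d dvd q" "d dvd r" "nid (real ((r - q) div d) * \<gamma>) < \<Delta>"
          using p by (auto simp: pqr)
        then have q: "2 ^ k \<le> q" "q \<le> 2 ^ (k + 1)" "q < r" "r \<le> 2 ^ (l + 1)"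
          by (auto simp: block_pairs_def bohr_def)
        have "0 < q" using q(1) by (metis gr0I le_zero_eq power_not_zero zero_neq_numeral)
        then have "0 < q div d" using qr(2) d by (auto simp: div_greater_zero_iff dvd_imp_le)
        moreover have "q div d \<le> 2 ^ (k + 1) div d" using q by (intro div_le_mono)
        moreover have "d dvd r - q" using qr by (auto intro: dvd_diff_nat)
        then have "0 < (r - q) div d" using q d by (auto simp: div_greater_zero_iff dvd_imp_le)
        moreover have "(r - q) div d \<le> 2 ^ (l + 1) div d" using q by (intro div_le_mono) auto
        ultimately show "?f p \<in> {1..2 ^ (k + 1) div d} \<times> ?N" using qr(4) by (auto simp: pqr)
      qed
      show "finite ({1..2 ^ (k + 1) div d} \<times> ?N)" by auto
    qed
    then have "(\<Sum>p\<in>block_pairs k l. of_bool (?P d p)) \<le> real (2 ^ (k + 1) div d) * real (card ?N)"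
      by (simp only: sum_of_bool_eq_card finite_block_pairs card_cartesian_product card_atLeastAtMost
          diff_Suc_1 of_nat_le_iff flip: of_nat_mult)
    also have "\<dots> \<le> (2 ^ (k + 1) / real d) * ((2 ^ (l + 1) / real d) * R)"
    proof (rule mult_mono)
      show "real (2 ^ (k + 1) div d) \<le> 2 ^ (k + 1) / real d"
        using of_nat_div_le_of_nat[of "2 ^ (k + 1)" d] by simp
      have "real (card ?N) \<le> real (2 ^ (l + 1) div d) * R"
        unfolding R_def by (rule G.card_nid_less_le[OF assms])
      also have "\<dots> \<le> (2 ^ (l + 1) / real d) * R"
        using of_nat_div_le_of_nat[of "2 ^ (l + 1)" d] R by (intro mult_right_mono) simp_all
      finally show "real (card ?N) \<le> (2 ^ (l + 1) / real d) * R" .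
    qed auto
    finally have "real d * (\<Sum>p\<in>block_pairs k l. of_bool (?P d p))
      \<le> real d * ((2 ^ (k + 1) / real d) * ((2 ^ (l + 1) / real d) * R))" by (intro mult_left_mono) auto
    also have "\<dots> = (4 * 2 ^ k * 2 ^ l * R) * (1 / real d)" using d by (simp add: field_simps)
    finally show "real d * (\<Sum>p\<in>block_pairs k l. of_bool (?P d p)) \<le> (4 * 2 ^ k * 2 ^ l * R) * (1 / real d)" .
  qed
  also have "\<dots> = (4 * 2 ^ k * 2 ^ l * R) * (\<Sum>d\<in>{1..2 ^ (k + 1)}. 1 / real d)"
    by (simp only: sum_distrib_left)
  also have "\<dots> \<le> (4 * 2 ^ k * 2 ^ l * R) * (real (k + 1) + 1)"
    using R by (intro mult_left_mono sum_inverse_le_log) auto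
  finally show ?thesis by (simp add: R_def)
qed

lemma sum_excess_block_le:
  assumes k: "K0 \<le> k" "k \<le> l"
  shows "(\<Sum>(q, r)\<in>block_pairs k l. excess q r)
     \<le> (1600 * (8 * real \<rho> + 1) + 128 * root \<rho> (64 / c)) * (real (k + 1) / 2 ^ (k div L) * root 8 (1/2) ^ (l - k))"
proof -
  define t where "t = k div L"
  define u where "u = l div L"
  define m where "m = l - k"
  define \<Delta> where "\<Delta> = 2 ^ (l - k + 3 * t + 5) / (2::real) ^ (8 * \<rho> * t)"
  \<comment> \<open>\<open>A\<close> is M^(-1/8). Of the saving 1/M = A^8, three factors pay for U^3
    via \<open>U * A \<le> 2 * T\<close>, four pay for the square root of \<open>M\<close> in the
    resonance bound, and one remains as the decay in \<open>l - k\<close>.\<close>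
  define x y T U M A C where "x = (2::real) ^ k" and "y = (2::real) ^ l" and "T = (2::real) ^ t"
    and "U = (2::real) ^ u" and "M = (2::real) ^ m" and "A = root 8 (1/2) ^ m" and "C = root \<rho> (64 / c)"
  have pos: "0 < x" "0 < y" "1 \<le> T" "0 < T" "0 < U" "1 \<le> M" by (auto simp: x_def y_def T_def U_def M_def)
  have a: "0 < root 8 (1/2::real)" "root 8 (1/2::real) \<le> 1" by auto
  have A: "0 < A" "A \<le> 1" unfolding A_def using a by (auto intro: power_le_one)
  have C: "0 \<le> C" unfolding C_def using B.c_pos B.rho_pos by simp
  have y: "y = x * M" unfolding x_def y_def M_def m_def using k by (simp flip: power_add)
  have MA: "M * A ^ 8 = 1"
  proof -
    have "A ^ 8 = (root 8 (1/2) ^ 8) ^ m" unfolding A_def by (simp only: mult.commute flip: power_mult)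
    also have "\<dots> = (1 / 2) ^ m" by simp
    finally show ?thesis by (simp add: M_def power_divide)
  qed
  have "8 \<le> L" using L_ge by simp
  have "u = (m + k) div L" using k by (simp add: u_def m_def)
  also have "\<dots> \<le> m div L + k div L + 1" using \<open>8 \<le> L\<close> by (intro div_add_le) auto
  also have "m div L \<le> m div 8" using \<open>8 \<le> L\<close> by (intro div_le_mono2) auto
  finally have ut: "u \<le> m div 8 + t + 1" by (simp add: t_def)
  have U: "U * A \<le> 2 * T"
  proof -
    have "A \<le> root 8 (1/2) ^ (8 * (m div 8))" unfolding A_def using a by (intro power_decreasing) auto
    also have "\<dots> = (1/2) ^ (m div 8)" by (simp add: power_mult)
    finally have "2 ^ (m div 8) * A \<le> 1" by (simp add: power_divide field_simps)
    moreover have "U \<le> 2 ^ (m div 8 + t + 1)" unfolding U_def using ut by (intro power_increasing) auto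
    then have "U \<le> 2 * T * 2 ^ (m div 8)" by (simp add: T_def power_add algebra_simps)
    then have "U * A \<le> 2 * T * 2 ^ (m div 8) * A" using A by (intro mult_right_mono) auto
    moreover have "2 * T * (2 ^ (m div 8) * A) \<le> 2 * T * 1"
      using calculation(1) pos by (intro mult_left_mono) auto
    ultimately show ?thesis by (simp add: algebra_simps)
  qed
  have \<Delta>: "0 < \<Delta>" by (simp add: \<Delta>_def)
  \<comment> \<open>The denominator of \<Delta> is a \<rho>-th power and yields T^8. In the
    numerator \<open>2 \<le> \<rho>\<close> allows the root to be replaced by a square root, so 2^m
    costs only A^(-4) and 2^(3t) at most T^2. The 64 in \<open>C\<close> is 2 times 2^5.\<close>
  have root_le: "root \<rho> (2 * \<Delta> / c) * (A ^ 4 * T ^ 6) \<le> C"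
  proof -
    have "2 * \<Delta> / c = (64 / c) * (2 ^ (m + 3 * t)) / (2 ^ (8 * t)) ^ \<rho>"
      by (simp add: \<Delta>_def m_def power_add algebra_simps flip: power_mult)
    then have "root \<rho> (2 * \<Delta> / c) = C * root \<rho> (2 ^ (m + 3 * t)) / 2 ^ (8 * t)"
      using B.rho_pos by (simp add: real_root_divide real_root_mult C_def real_root_power_cancel)
    also have "\<dots> \<le> C * sqrt (2 ^ (m + 3 * t)) / 2 ^ (8 * t)"
      unfolding sqrt_def using rho_ge C
      by (intro divide_right_mono mult_left_mono real_root_decreasing) auto
    also have "\<dots> \<le> C * (T ^ 2 / A ^ 4) / T ^ 8"
    proof -
      have "2 ^ (m + 3 * t) \<le> (T ^ 2 / A ^ 4) ^ 2"
      proof -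
        have "(2::real) ^ (m + 3 * t) = M * T ^ 3" by (simp add: M_def T_def power_add mult.commute flip: power_mult)
        also have "\<dots> \<le> M * T ^ 4" using pos by (intro mult_left_mono power_increasing) auto
        also have "\<dots> = (T ^ 2 / A ^ 4) ^ 2"
          using MA A by (simp add: power_divide field_simps flip: power_mult)
        finally show ?thesis .
      qed
      then have "sqrt (2 ^ (m + 3 * t)) \<le> T ^ 2 / A ^ 4"
        using A pos by (intro real_le_lsqrt) auto
      moreover have "2 ^ (8 * t) = T ^ 8" by (simp add: T_def mult.commute flip: power_mult)
      ultimately show ?thesis
        using C pos by (simp only:) (intro divide_right_mono mult_left_mono, auto)
    qed
    finally have "root \<rho> (2 * \<Delta> / c) * (A ^ 4 * T ^ 6) \<le> C * (T ^ 2 / A ^ 4) / T ^ 8 * (A ^ 4 * T ^ 6)"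
      using A pos by (intro mult_right_mono) auto
    also have "\<dots> = C" using A pos by (simp add: field_simps flip: power_add)
    finally show ?thesis .
  qed
  let ?S1 = "\<Sum>(q, r)\<in>block_pairs k l. \<Sum>d\<in>{1..2 ^ (8 * \<rho> * t)}. real d * of_bool (d dvd q \<and> d dvd r)"
  let ?S2 = "\<Sum>(q, r)\<in>block_pairs k l. \<Sum>d\<in>{1..2 ^ (k + 1)}.
       real d * of_bool (d dvd q \<and> d dvd r \<and> nid (real ((r - q) div d) * \<gamma>) < \<Delta>)"
  have "(\<Sum>(q, r)\<in>block_pairs k l. excess q r)
    \<le> (\<Sum>(q, r)\<in>block_pairs k l. 2 * (2 ^ (3 * u) / (2 ^ l * 2 ^ l)) *
     ((\<Sum>d\<in>{1..2 ^ (8 * \<rho> * t)}. real d * of_bool (d dvd q \<and> d dvd r)) +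
      (\<Sum>d\<in>{1..2 ^ (k + 1)}. real d * of_bool (d dvd q \<and> d dvd r \<and> nid (real ((r - q) div d) * \<gamma>) < \<Delta>))))"
    unfolding t_def u_def \<Delta>_def by (intro sum_mono) (clarify, rule excess_le[OF k])
  also have "\<dots> = 2 * (2 ^ (3 * u) / (2 ^ l * 2 ^ l)) * (?S1 + ?S2)"
    by (simp only: case_prod_unfold sum.distrib sum_distrib_left distrib_left)
  also have "\<dots> = 2 * (U ^ 3 / (y * y)) * ?S1 + 2 * (U ^ 3 / (y * y)) * ?S2"
    by (simp add: U_def y_def distrib_left mult.commute flip: power_mult)
  also have "2 * (U ^ 3 / (y * y)) * ?S1 \<le> 1600 * (8 * real \<rho> + 1) * (real (k + 1) * A / T)"
  proof -
    have "?S1 \<le> 400 * (2 ^ k / 2 ^ (2 * t)) * (2 ^ l / 2 ^ (2 * u)) * (real (8 * \<rho> * t) + 1)"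
      unfolding t_def u_def by (rule sum_common_divisors_le[OF k])
    also have "\<dots> = 400 * (x / T ^ 2) * (y / U ^ 2) * (real (8 * \<rho> * t) + 1)"
      by (simp add: x_def y_def T_def U_def mult.commute[of 2] power_mult)
    also have "\<dots> \<le> 400 * (x / T ^ 2) * (y / U ^ 2) * ((8 * real \<rho> + 1) * real (k + 1))"
    proof (rule mult_left_mono)
      have "t \<le> k" by (simp add: t_def)
      then have "8 * real \<rho> * real t \<le> 8 * real \<rho> * real k" by (intro mult_left_mono) auto
      then show "real (8 * \<rho> * t) + 1 \<le> (8 * real \<rho> + 1) * real (k + 1)" by (simp add: algebra_simps)
    qed (use pos in auto)
    finally have "2 * (U ^ 3 / (y * y)) * ?S1
      \<le> 2 * (U ^ 3 / (y * y)) * (400 * (x / T ^ 2) * (y / U ^ 2) * ((8 * real \<rho> + 1) * real (k + 1)))"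
      using pos by (intro mult_left_mono) auto
    also have "\<dots> = 800 * ((8 * real \<rho> + 1) * real (k + 1)) * (U * (1 / M) / T ^ 2)"
      using pos by (simp add: y power2_eq_square power3_eq_cube field_simps)
    also have "\<dots> \<le> 800 * ((8 * real \<rho> + 1) * real (k + 1)) * (2 * (A / T))"
    proof (rule mult_left_mono)
      have "1 / M = A ^ 8" using MA pos by (simp add: field_simps)
      then have "U * (1 / M) = (U * A) * A ^ 7" by (simp add: power_Suc[symmetric] mult.assoc)
      also have "\<dots> \<le> (2 * T) * A ^ 1" using A pos by (intro mult_mono[OF U] power_decreasing) auto
      finally have "U * (1 / M) / T ^ 2 \<le> (2 * T) * A ^ 1 / T ^ 2" by (intro divide_right_mono) auto
      then show "U * (1 / M) / T ^ 2 \<le> 2 * (A / T)" using pos by (simp add: power2_eq_square)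
    qed auto
    also have "\<dots> = 1600 * (8 * real \<rho> + 1) * (real (k + 1) * A / T)" by simp
    finally show ?thesis .
  qed
  also have "2 * (U ^ 3 / (y * y)) * ?S2 \<le> 128 * C * (real (k + 1) * A / T)"
  proof -
    have "?S2 \<le> 4 * 2 ^ k * 2 ^ l * root \<rho> (2 * \<Delta> / c) * (real (k + 1) + 1)"
      by (rule sum_resonant_divisors_le[OF \<Delta>])
    then have "2 * (U ^ 3 / (y * y)) * ?S2
      \<le> 2 * (U ^ 3 / (y * y)) * (4 * x * y * root \<rho> (2 * \<Delta> / c) * (real (k + 1) + 1))"
      unfolding x_def[symmetric] y_def[symmetric] using pos by (intro mult_left_mono) auto
    also have "\<dots> = 8 * (real (k + 1) + 1) * (U ^ 3 * (1 / M) * root \<rho> (2 * \<Delta> / c))"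
      using pos by (simp add: y field_simps)
    also have "\<dots> \<le> 8 * (2 * real (k + 1)) * (8 * C * (A / T))"
    proof (rule mult_mono)
      have R: "0 \<le> root \<rho> (2 * \<Delta> / c)" using B.rho_pos \<Delta> B.c_pos by simp
      have "1 / M = A ^ 8" using MA pos by (simp add: field_simps)
      then have "U ^ 3 * (1 / M) * root \<rho> (2 * \<Delta> / c) = (U * A) ^ 3 * (root \<rho> (2 * \<Delta> / c) * (A ^ 4 * T ^ 6)) * (A / T ^ 6)"
        using pos by (simp add: power_mult_distrib flip: power_add power_Suc2)
      also have "\<dots> \<le> (2 * T) ^ 3 * C * (A / T ^ 6)"
      proof (rule mult_right_mono)
        have "(U * A) ^ 3 \<le> (2 * T) ^ 3" using A pos by (intro power_mono[OF U]) auto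
        then show "(U * A) ^ 3 * (root \<rho> (2 * \<Delta> / c) * (A ^ 4 * T ^ 6)) \<le> (2 * T) ^ 3 * C"
          using A pos R by (intro mult_mono[OF _ root_le]) auto
      qed (use A pos in auto)
      also have "\<dots> = 8 * C * A * (1 / T ^ 3)" using pos by (simp add: field_simps flip: power_add)
      also have "\<dots> \<le> 8 * C * A * (1 / T ^ 1)"
        using pos C A by (intro mult_left_mono divide_left_mono power_increasing) auto
      finally show "U ^ 3 * (1 / M) * root \<rho> (2 * \<Delta> / c) \<le> 8 * C * (A / T)" by simp
      show "0 \<le> U ^ 3 * (1 / M) * root \<rho> (2 * \<Delta> / c)" using pos R by auto
    qed auto
    also have "\<dots> = 128 * C * (real (k + 1) * A / T)" by simp
    finally show ?thesis .
  qed
  finally have "(\<Sum>(q, r)\<in>block_pairs k l. excess q r)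
    \<le> 1600 * (8 * real \<rho> + 1) * (real (k + 1) * A / T) + 128 * C * (real (k + 1) * A / T)" by simp
  also have "\<dots> = (1600 * (8 * real \<rho> + 1) + 128 * C) * (real (k + 1) / T * A)"
    by (simp only: distrib_right times_divide_eq_left)
  finally show ?thesis unfolding A_def T_def C_def m_def t_def .
qed

section \<open>Total excess over all pairs\<close>

lemma bohr_block_unique:
  assumes "q \<in> bohr \<beta> z L k" "q \<in> bohr \<beta> z L l"
  shows "k = l"
proof -
  have less: "i < j + 1" if "q \<in> bohr \<beta> z L i" "q \<in> bohr \<beta> z L j" for i j
  proof -
    have "(2::nat) ^ i < 2 ^ (j + 1)" using that by (auto simp: bohr_def)
    then show ?thesis by (rule power_less_imp_less_exp[rotated]) simp
  qed
  then show ?thesis using less[OF assms] less[OF assms(2,1)] by simp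
qed

lemma summable_block_weights: "summable (\<lambda>k. real (k + 1) / 2 ^ (k div L))"
proof (rule summable_comparison_test)
  have L: "0 < L" using L_ge by simp
  define b where "b = root L (1/2::real)"
  have b: "0 < b" "b < 1" "b ^ L = 1/2" unfolding b_def using L by auto
  \<comment> \<open>The differentiated geometric series supplies the weights n + 1; rounding
    \<open>n\<close> to a multiple of \<open>L\<close> costs the factor 2 = 1 / b^L.\<close>
  have "summable (\<lambda>n. diffs (\<lambda>_. 1) n * b ^ n)"
    by (rule termdiff_converges[of _ 1]) (use b in \<open>auto intro: summable_geometric\<close>)
  then have "summable (\<lambda>n. 2 * (diffs (\<lambda>_. 1) n * b ^ n))" by (rule summable_mult)
  then show "summable (\<lambda>n. 2 * (real (n + 1) * b ^ n))" by (simp add: diffs_def)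
  have "1 / 2 ^ (n div L) \<le> 2 * b ^ n" for n
  proof -
    have "n \<le> L * (n div L + 1)" using dividend_less_times_div[OF L, of n] by simp
    then have "b ^ (L * (n div L + 1)) \<le> b ^ n" using b by (intro power_decreasing) auto
    then have "(1/2) ^ (n div L + 1) \<le> b ^ n" by (simp only: power_mult b(3))
    then show ?thesis by (simp add: power_divide)
  qed
  then have "real (n + 1) * (1 / 2 ^ (n div L)) \<le> real (n + 1) * (2 * b ^ n)" for n
    by (intro mult_left_mono) auto
  then show "\<exists>N. \<forall>n\<ge>N. norm (real (n + 1) / 2 ^ (n div L)) \<le> 2 * (real (n + 1) * b ^ n)"
    by (simp add: algebra_simps)
qed

text \<open>The block bounds form the Cauchy product of two convergent series, one in the smaller
  block index and one in the distance of the blocks.\<close>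

lemma sum_excess_bounded:
  obtains C where "\<And>N. (\<Sum>r<N. \<Sum>q<r. excess q r) \<le> C"
proof -
  define D where "D = 1600 * (8 * real \<rho> + 1) + 128 * root \<rho> (64 / c)"
  define F where "F k = real (k + 1) / 2 ^ (k div L)" for k
  define a where "a = root 8 (1/2::real)"
  have a: "0 < a" "a < 1" by (auto simp: a_def)
  have F0: "0 \<le> F k" for k by (simp add: F_def)
  have D0: "0 \<le> D" unfolding D_def using B.c_pos B.rho_pos by simp
  have sm: "summable (\<lambda>l. \<Sum>k\<le>l. F k * a ^ (l - k))"
  proof (rule summable_Cauchy_product)
    show "summable (\<lambda>k. norm (F k))" using summable_block_weights by (simp add: F_def)
    show "summable (\<lambda>k. norm (a ^ k))" using a by (simp add: norm_power)
  qed
  have "(\<Sum>r<N. \<Sum>q<r. excess q r) \<le> D * (\<Sum>l. \<Sum>k\<le>l. F k * a ^ (l - k))" for N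
  proof -
    let ?I = "Sigma {..<N} (\<lambda>l. {K0..l})"
    let ?T = "Sigma {..<N} (\<lambda>r. {..<r})"
    let ?U = "\<Union>(l, k)\<in>?I. block_pairs k l"
    have finU: "finite ?U" by auto
    have ex0: "0 \<le> excess q r" for q r by (simp add: excess_def)
    have "(\<Sum>r<N. \<Sum>q<r. excess q r) = (\<Sum>(r, q)\<in>?T. excess q r)" by (simp add: sum.Sigma)
    also have "\<dots> = (\<Sum>(q, r)\<in>(\<lambda>(r, q). (q, r)) ` ?T. excess q r)"
      by (subst sum.reindex) (auto simp: inj_on_def case_prod_unfold)
    \<comment> \<open>Pairs outside all blocks have a zero radius, hence zero excess.\<close>
    also have "\<dots> = (\<Sum>(q, r)\<in>(\<lambda>(r, q). (q, r)) ` ?T \<inter> ?U. excess q r)"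
    proof (rule sum.mono_neutral_right)
      show "\<forall>p\<in>(\<lambda>(r, q). (q, r)) ` ?T - (\<lambda>(r, q). (q, r)) ` ?T \<inter> ?U. (case p of (q, r) \<Rightarrow> excess q r) = 0"
      proof clarify
        fix q r assume qr: "r < N" "q < r" and notU: "(q, r) \<notin> (\<lambda>(r, q). (q, r)) ` ?T \<inter> ?U"
        show "excess q r = 0"
        proof (rule ccontr)
          assume "excess q r \<noteq> 0"
          then have "\<delta> q \<noteq> 0" "\<delta> r \<noteq> 0" using excess_zero by blast+
          then obtain k l where kl: "K0 \<le> k" "q \<in> bohr \<beta> z L k" "r \<in> bohr \<beta> z L l"
            using radius_supp by blast
          have "(2::nat) ^ k < 2 ^ (l + 1)" using kl qr by (auto simp: bohr_def)
          then have "k < l + 1" by (rule power_less_imp_less_exp[rotated]) simp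
          then have "k \<le> l" by simp
          \<comment> \<open>From 2^l \<le> r < N < 2^N the block index is below \<open>N\<close>, so
            finitely many blocks contain all relevant pairs.\<close>
          moreover have "2 ^ l \<le> r" using kl(3) by (auto simp: bohr_def)
          then have "(2::nat) ^ l < 2 ^ N" using qr(1) less_exp[of N] by linarith
          then have "l < N" by (rule power_less_imp_less_exp[rotated]) simp
          moreover have "(q, r) \<in> block_pairs k l" using kl qr by (auto simp: block_pairs_def)
          ultimately have "(q, r) \<in> (\<lambda>(r, q). (q, r)) ` ?T \<inter> ?U" using kl(1) qr by force
          then show False using notU by simp
        qed
      qed
    qed auto
    also have "\<dots> \<le> (\<Sum>(q, r)\<in>?U. excess q r)"
      by (rule sum_mono2[OF finU]) (use ex0 in auto)
    also have "\<dots> = (\<Sum>i\<in>?I. \<Sum>(q, r)\<in>(case i of (l, k) \<Rightarrow> block_pairs k l). excess q r)"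
    proof (rule sum.UNION_disjoint)
      show "\<forall>i\<in>?I. \<forall>j\<in>?I. i \<noteq> j \<longrightarrow> (case i of (l, k) \<Rightarrow> block_pairs k l) \<inter> (case j of (l, k) \<Rightarrow> block_pairs k l) = {}"
        using bohr_block_unique by (auto simp: block_pairs_def)
    qed auto
    also have "\<dots> = (\<Sum>(l, k)\<in>?I. \<Sum>(q, r)\<in>block_pairs k l. excess q r)"
      by (intro sum.cong) auto
    also have "\<dots> \<le> (\<Sum>(l, k)\<in>?I. D * (F k * a ^ (l - k)))"
    proof (rule sum_mono)
      fix i assume i: "i \<in> ?I"
      obtain l k where lk: "i = (l, k)" by (cases i)
      have "(\<Sum>(q, r)\<in>block_pairs k l. excess q r) \<le> D * (F k * a ^ (l - k))"
        unfolding D_def F_def a_def using i lk by (intro sum_excess_block_le) auto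
      then show "(case i of (l, k) \<Rightarrow> \<Sum>(q, r)\<in>block_pairs k l. excess q r)
        \<le> (case i of (l, k) \<Rightarrow> D * (F k * a ^ (l - k)))" by (simp add: lk)
    qed
    also have "\<dots> = (\<Sum>l<N. \<Sum>k\<in>{K0..l}. D * (F k * a ^ (l - k)))" by (simp add: sum.Sigma)
    also have "\<dots> \<le> (\<Sum>l<N. \<Sum>k\<le>l. D * (F k * a ^ (l - k)))"
      using a F0 D0 by (intro sum_mono sum_mono2) auto
    also have "\<dots> = D * (\<Sum>l<N. \<Sum>k\<le>l. F k * a ^ (l - k))" by (simp only: sum_distrib_left)
    also have "\<dots> \<le> D * (\<Sum>l. \<Sum>k\<le>l. F k * a ^ (l - k))"
      using a F0 D0 by (intro mult_left_mono sum_le_suminf sm) (auto intro!: sum_nonneg)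
    finally show ?thesis .
  qed
  then show ?thesis using that by blast
qed

section \<open>Almost every point is hit infinitely often\<close>

definition hit_set :: "nat \<Rightarrow> real set" where
  "hit_set q = {0..<1} \<inter> near_set \<gamma> q (\<delta> q)"

lemma measure_hit_set: "measure lborel (hit_set q) = 2 * \<delta> q"
proof (cases "\<delta> q = 0")
  case True
  moreover have "near_set \<gamma> q 0 = {}" by (simp add: near_set_def not_less)
  ultimately show ?thesis by (simp add: hit_set_def)
next
  case False
  then obtain k where "q \<in> bohr \<beta> z L k" using radius_supp by blast
  then have "2 ^ k \<le> q" by (simp add: bohr_def)
  then have "0 < q" by (metis gr0I le_zero_eq power_not_zero zero_neq_numeral)
  then show ?thesis unfolding hit_set_def by (intro measure_near_set radius_nonneg radius_le_half)
qed

lemma AE_infinite_near: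
  assumes div: "\<not> summable \<delta>"
  shows "AE x in lborel. x \<in> {0..<1} \<longrightarrow> infinite {q. nid (real q * x - \<gamma>) < \<delta> q}"
proof -
  let ?M = "restrict_space lborel {0..<1::real}"
  have sp: "space ?M = {0..<1}" by (simp add: space_restrict_space)
  interpret P: prob_space ?M
    by (rule prob_spaceI) (simp add: sp emeasure_restrict_space)
  have prob: "measure ?M A = measure lborel A" if "A \<subseteq> {0..<1}" for A
    using that by (intro measure_restrict_space) auto
  have hit01: "hit_set q \<subseteq> {0..<1}" for q by (auto simp: hit_set_def)
  obtain C where C: "\<And>N. (\<Sum>r<N. \<Sum>q<r. excess q r) \<le> C" using sum_excess_bounded by blast
  have "AE x in ?M. infinite {n. x \<in> hit_set n}"
  proof (rule P.borel_cantelli_bounded_correlation)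
    show "hit_set n \<in> P.events" for n
      by (auto simp: sets_restrict_space hit_set_def)
    have p: "measure ?M (hit_set n) = 2 * \<delta> n" for n
      using prob[OF hit01] measure_hit_set by simp
    have mono: "(\<Sum>n<N. 2 * \<delta> n) \<le> (\<Sum>n<N'. 2 * \<delta> n)" if "N \<le> N'" for N N'
      using that radius_nonneg by (intro sum_mono2) auto
    have "\<exists>N. Z \<le> (\<Sum>n<N. 2 * \<delta> n)" for Z
    proof (rule ccontr)
      assume "\<nexists>N. Z \<le> (\<Sum>n<N. 2 * \<delta> n)"
      then have lt: "2 * (\<Sum>n<N. \<delta> n) < Z" for N
        by (simp add: sum_distrib_left not_le)
      have "(\<Sum>n<N. \<delta> n) \<le> Z / 2" for N
        using lt[of N] by linarith
      then have "summable \<delta>" using radius_nonneg by (intro summableI_nonneg_bounded)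
      then show False using div by simp
    qed
    then show "filterlim (\<lambda>N. \<Sum>n<N. measure ?M (hit_set n)) at_top sequentially"
      unfolding filterlim_at_top eventually_sequentially p using order_trans[OF _ mono] by blast
    show "(\<Sum>n<N. \<Sum>m<n. measure ?M (hit_set m \<inter> hit_set n))
      \<le> (\<Sum>n<N. \<Sum>m<n. measure ?M (hit_set m) * measure ?M (hit_set n)) + C" for N
    proof -
      have "measure ?M (hit_set m \<inter> hit_set n) \<le> 2 * \<delta> m * (2 * \<delta> n) + excess m n" for m n
      proof -
        have "hit_set m \<inter> hit_set n = {0..<1} \<inter> (near_set \<gamma> m (\<delta> m) \<inter> near_set \<gamma> n (\<delta> n))"
          by (auto simp: hit_set_def)
        moreover have "measure ?M (hit_set m \<inter> hit_set n) = measure lborel (hit_set m \<inter> hit_set n)"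
          using hit01 by (intro prob) auto
        ultimately show ?thesis by (simp add: excess_def)
      qed
      then have "(\<Sum>n<N. \<Sum>m<n. measure ?M (hit_set m \<inter> hit_set n))
        \<le> (\<Sum>n<N. \<Sum>m<n. 2 * \<delta> m * (2 * \<delta> n) + excess m n)" by (intro sum_mono)
      also have "\<dots> = (\<Sum>n<N. \<Sum>m<n. 2 * \<delta> m * (2 * \<delta> n)) + (\<Sum>n<N. \<Sum>m<n. excess m n)"
        by (simp only: sum.distrib)
      also have "\<dots> \<le> (\<Sum>n<N. \<Sum>m<n. 2 * \<delta> m * (2 * \<delta> n)) + C" using C[of N] by simp
      finally show ?thesis by (simp only: p)
    qed
  qed
  then have "AE x in lborel. x \<in> {0..<1} \<longrightarrow> infinite {n. x \<in> hit_set n}"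
    by (subst (asm) AE_restrict_space_iff) auto
  then show ?thesis
  proof eventually_elim
    case (elim x)
    show ?case
    proof
      assume x: "x \<in> {0..<1}"
      then have "{n. x \<in> hit_set n} = {q. nid (real q * x - \<gamma>) < \<delta> q}"
        by (auto simp: hit_set_def near_set_def)
      then show "infinite {q. nid (real q * x - \<gamma>) < \<delta> q}" using elim x by simp
    qed
  qed
qed

end

section \<open>Divergence and the main theorem\<close>

text \<open>Cauchy condensation: on the block from 2^K to 2^(K+1), \<psi> is largest at the left end
  and the logarithm is below K + 1.\<close>

lemma sum_le_dyadic_sum:
  fixes \<psi> :: "nat \<Rightarrow> real"
  assumes pos: "\<And>q. 1 \<le> q \<Longrightarrow> 0 < \<psi> q" and mono: "\<And>q r. 1 \<le> q \<Longrightarrow> q \<le> r \<Longrightarrow> \<psi> r \<le> \<psi> q"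
  shows "(\<Sum>q\<in>{1..<2 ^ K}. \<psi> q * log 2 (real q)) \<le> (\<Sum>j<K. real (j + 1) * (2 ^ j * \<psi> (2 ^ j)))"
proof (induction K)
  case (Suc K)
  have "{1..<2 ^ Suc K} = {1..<2 ^ K} \<union> {2 ^ K..<2 ^ Suc K::nat}" by auto
  then have "(\<Sum>q\<in>{1..<2 ^ Suc K}. \<psi> q * log 2 (real q))
    = (\<Sum>q\<in>{1..<2 ^ K}. \<psi> q * log 2 (real q)) + (\<Sum>q\<in>{2 ^ K..<2 ^ Suc K}. \<psi> q * log 2 (real q))"
    by (simp only:) (rule sum.union_disjoint; auto)
  also have "(\<Sum>q\<in>{2 ^ K..<2 ^ Suc K}. \<psi> q * log 2 (real q)) \<le> (\<Sum>q\<in>{2 ^ K..<2 ^ Suc K::nat}. \<psi> (2 ^ K) * real (K + 1))"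
  proof (rule sum_mono)
    fix q :: nat assume q: "q \<in> {2 ^ K..<2 ^ Suc K}"
    have "(1::nat) \<le> 2 ^ K" by simp
    then have q1: "1 \<le> q" using q by (meson atLeastLessThan_iff le_trans)
    have "real q < real (2 ^ Suc K)" using q by (simp only: of_nat_less_iff) simp
    then have "log 2 (real q) < log 2 (2 ^ Suc K)" using q1 by (subst log_less_cancel_iff) auto
    also have "\<dots> = real (Suc K)" by (subst log_nat_power) auto
    finally show "\<psi> q * log 2 (real q) \<le> \<psi> (2 ^ K) * real (K + 1)"
      using q q1 mono[of "2 ^ K" q] pos[of "2 ^ K"] by (intro mult_mono) auto
  qed
  also have "\<dots> = real (K + 1) * (2 ^ K * \<psi> (2 ^ K))" by simp
  finally show ?case using Suc.IH by simp
qed simp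

(* If 2^j psi(2^j) >= 1 for infinitely many j, single terms of the truncated sum are already
   unbounded; otherwise the truncation is eventually void. *)
lemma dyadic_min_sum_unbounded:
  fixes \<psi> :: "nat \<Rightarrow> real"
  assumes pos: "\<And>q. 1 \<le> q \<Longrightarrow> 0 < \<psi> q" and mono: "\<And>q r. 1 \<le> q \<Longrightarrow> q \<le> r \<Longrightarrow> \<psi> r \<le> \<psi> q"
    and div: "filterlim (\<lambda>N. \<Sum>q=1..N. \<psi> q * log 2 (real q)) at_top sequentially"
  shows "\<exists>K. B < (\<Sum>j\<in>{K0..<K}. real (j + 1) * min (2 ^ j * \<psi> (2 ^ j)) 1)"
proof (rule ccontr)
  define h where "h j = 2 ^ j * \<psi> (2 ^ j)" for j :: nat
  have h: "0 < h j" for j unfolding h_def by (simp add: pos)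
  assume "\<nexists>K. B < (\<Sum>j\<in>{K0..<K}. real (j + 1) * min (2 ^ j * \<psi> (2 ^ j)) 1)"
  then have le: "(\<Sum>j\<in>{K0..<K}. real (j + 1) * min (h j) 1) \<le> B" for K by (simp add: h_def not_less)
  have term_le: "real (j + 1) * min (h j) 1 \<le> B" if "K0 \<le> j" for j
  proof -
    have "real (j + 1) * min (h j) 1 \<le> (\<Sum>j\<in>{K0..<Suc j}. real (j + 1) * min (h j) 1)"
      by (rule member_le_sum) (use that h in \<open>auto simp: less_imp_le\<close>)
    then show ?thesis using le[of "Suc j"] by linarith
  qed
  define K1 where "K1 = max K0 (nat \<lceil>B\<rceil>)"
  have h1: "min (h j) 1 = h j" if "K1 \<le> j" for j
  proof (rule ccontr)
    assume "min (h j) 1 \<noteq> h j"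
    then have "real (j + 1) \<le> B" using term_le[of j] that by (auto simp: K1_def min_def split: if_splits)
    moreover have "B \<le> real j" using that unfolding K1_def by linarith
    ultimately show False by simp
  qed
  have bound: "(\<Sum>j<K. real (j + 1) * h j) \<le> (\<Sum>j<K1. real (j + 1) * h j) + B" for K
  proof -
    have "(\<Sum>j<K. real (j + 1) * h j) \<le> (\<Sum>j\<in>{..<K1} \<union> {K1..<K}. real (j + 1) * h j)"
      using h by (intro sum_mono2) (auto simp: less_imp_le)
    also have "\<dots> = (\<Sum>j<K1. real (j + 1) * h j) + (\<Sum>j\<in>{K1..<K}. real (j + 1) * h j)"
      by (rule sum.union_disjoint) auto
    also have "(\<Sum>j\<in>{K1..<K}. real (j + 1) * h j) = (\<Sum>j\<in>{K1..<K}. real (j + 1) * min (h j) 1)"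
      using h1 by (intro sum.cong) auto
    also have "\<dots> \<le> (\<Sum>j\<in>{K0..<K}. real (j + 1) * min (h j) 1)"
      using h by (intro sum_mono2) (auto simp: K1_def less_imp_le)
    finally show ?thesis using le[of K] by linarith
  qed
  define B' where "B' = (\<Sum>j<K1. real (j + 1) * h j) + B"
  obtain N where N: "\<And>n. N \<le> n \<Longrightarrow> B' + 1 \<le> (\<Sum>q=1..n. \<psi> q * log 2 (real q))"
    using div unfolding filterlim_at_top eventually_sequentially by blast
  have "B' + 1 \<le> (\<Sum>q=1..N. \<psi> q * log 2 (real q))" by (rule N) simp
  also have "\<dots> \<le> (\<Sum>q\<in>{1..<2 ^ N}. \<psi> q * log 2 (real q))"
    using pos le_less_trans[OF _ less_exp[of N]]
    by (intro sum_mono2) (auto intro!: mult_nonneg_nonneg simp: less_imp_le Suc_le_eq)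
  also have "\<dots> \<le> (\<Sum>j<N. real (j + 1) * (2 ^ j * \<psi> (2 ^ j)))" by (rule sum_le_dyadic_sum[OF pos mono])
  also have "\<dots> \<le> B'" using bound[of N] by (simp add: B'_def h_def)
  finally show False by simp
qed

text \<open>Taking \<open>n1 = 0\<close> or \<open>n2 = 0\<close> gives the separate conditions on
  \<beta> and \<gamma>. Raising the exponent to a natural number only weakens the bound since
  \<open>n\<close> is at least 1; it is made at least 2 for the comparison with a square root in
  \<open>sum_excess_block_le\<close>.\<close>

lemma Diophantine_pair_D:
  assumes "Diophantine_pair \<gamma> \<beta>"
  obtains c :: real and \<rho> :: nat where "2 \<le> \<rho>" "diophantine_real \<beta> c \<rho>" "diophantine_real \<gamma> c \<rho>"
proof -
  obtain \<rho>' c where "\<rho>' > 0" and c: "c > 0" and *: "\<And>n1 n2 :: int. (n1, n2) \<noteq> (0, 0) \<Longrightarrow>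
        nid (of_int n1 * \<gamma> + of_int n2 * \<beta>) \<ge> c * real_of_int (max \<bar>n1\<bar> \<bar>n2\<bar>) powr (- \<rho>')"
    using assms unfolding Diophantine_pair_def by blast
  define \<rho> where "\<rho> = max 2 (nat \<lceil>\<rho>'\<rceil>)"
  have le: "c / real n ^ \<rho> \<le> c * real n powr (- \<rho>')" if "0 < n" for n :: nat
  proof -
    have "\<rho>' \<le> real \<rho>" unfolding \<rho>_def by linarith
    then have "real n powr (- real \<rho>) \<le> real n powr (- \<rho>')" using that by (intro powr_mono) auto
    moreover have "real n powr (- real \<rho>) = 1 / real n ^ \<rho>"
      using that by (simp add: powr_minus powr_realpow divide_inverse)
    ultimately show ?thesis using c by (metis less_imp_le mult_left_mono mult.right_neutral times_divide_eq_right)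
  qed
  show ?thesis
  proof (rule that[of \<rho> c])
    show "2 \<le> \<rho>" by (simp add: \<rho>_def)
    show "diophantine_real \<beta> c \<rho>"
    proof
      fix n :: nat assume "0 < n"
      then show "c / real n ^ \<rho> \<le> nid (real n * \<beta>)" using *[of 0 "int n"] le[of n] by simp
    qed (use c in \<open>auto simp: \<rho>_def\<close>)
    show "diophantine_real \<gamma> c \<rho>"
    proof
      fix n :: nat assume "0 < n"
      then show "c / real n ^ \<rho> \<le> nid (real n * \<gamma>)" using *[of "int n" 0] le[of n] by simp
    qed (use c in \<open>auto simp: \<rho>_def\<close>)
  qed
qed

lemma AE_in_W:
  fixes \<psi> :: "nat \<Rightarrow> real" and \<beta> \<gamma> \<gamma>' c :: real
  assumes pos: "\<And>q. 1 \<le> q \<Longrightarrow> 0 < \<psi> q" and mono: "\<And>q r. 1 \<le> q \<Longrightarrow> q \<le> r \<Longrightarrow> \<psi> r \<le> \<psi> q"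
    and div: "filterlim (\<lambda>N. \<Sum>q=1..N. \<psi> q * log 2 (real q)) at_top sequentially"
    and rho: "2 \<le> \<rho>" and D: "diophantine_real \<beta> c \<rho>" "diophantine_real \<gamma> c \<rho>"
  shows "AE x in lborel. x \<in> {0..<1} \<longrightarrow> x \<in> W \<psi> \<beta> \<gamma> \<gamma>'"
proof -
  interpret B: diophantine_real \<beta> c \<rho> by (rule D)
  \<comment> \<open>The part \<rho> (w + 5) + w with w = 8 \<rho> is what
    \<open>card_bohr_dvd_le\<close> requires for divisors up to 2^(8 \<rho> t). The summand 8 gives
    \<open>8 \<le> L\<close>, which keeps the radii at most 1/2 and makes the level grow slowly from
    block to block.\<close>
  define L where "L = \<rho> * (8 * \<rho> + 5) + 8 * \<rho> + 8"
  have L8: "8 \<le> L" by (simp add: L_def)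
  obtain t0 where t0: "1 / c < 2 ^ t0" using real_arch_pow[of 2 "1 / c"] by auto
  \<comment> \<open>From block \<open>K0\<close> on the level is at least \<open>t0\<close>, which
    absorbs the constant \<open>c\<close>, and at least 4, as \<open>sum_inverse_bohr_ge\<close>
    requires.\<close>
  define K0 where "K0 = L * max 4 t0"
  have K0L: "K0 div L = max 4 t0" unfolding K0_def using L8 by simp
  have const: "1 \<le> c * 2 ^ (k div L)" "4 \<le> k div L" if "K0 \<le> k" for k
  proof -
    have t: "max 4 t0 \<le> k div L" using div_le_mono[OF that, of L] K0L by simp
    then show "4 \<le> k div L" by simp
    have "(2::real) ^ t0 \<le> 2 ^ (k div L)" using t by (intro power_increasing) auto
    then have "1 / c < 2 ^ (k div L)" using t0 by linarith
    then show "1 \<le> c * 2 ^ (k div L)" using B.c_pos by (simp add: field_simps)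
  qed
  define \<phi> where "\<phi> q = min (\<psi> q) (1 / real q)" for q
  define Q where "Q = (\<Union>k\<in>{K0..}. bohr \<beta> \<gamma>' L k)"
  define \<delta> where "\<delta> q = (if q \<in> Q then \<phi> q / nid (real q * \<beta> - \<gamma>') else 0)" for q
  have bohrD: "1 \<le> q" "2 ^ k \<le> real q" "q \<le> 2 ^ (k + 1)" "0 < nid (real q * \<beta> - \<gamma>')" "0 < \<phi> q"
    "\<delta> q = \<phi> q / nid (real q * \<beta> - \<gamma>')" "\<delta> q \<le> 2 ^ (3 * (k div L)) / 2 ^ k" "\<delta> q \<le> 1/2"
    if k: "K0 \<le> k" and q: "q \<in> bohr \<beta> \<gamma>' L k" for k q
  proof -
    have q2: "2 ^ k \<le> q" "q < 2 ^ (k + 1)" "1 / 2 ^ (3 * (k div L)) \<le> nid (real q * \<beta> - \<gamma>')"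
      using q by (auto simp: bohr_def)
    show "q \<le> 2 ^ (k + 1)" using q2 by simp
    have "(1::nat) \<le> 2 ^ k" by simp
    then show q1: "1 \<le> q" using q2(1) by (rule order_trans)
    show qk: "2 ^ k \<le> real q" using q2(1) by (metis of_nat_le_iff of_nat_numeral of_nat_power)
    have p: "0 < 1 / (2::real) ^ (3 * (k div L))" by simp
    then show n0: "0 < nid (real q * \<beta> - \<gamma>')" using q2(3) by linarith
    show f0: "0 < \<phi> q" using q1 pos by (simp add: \<phi>_def)
    have "q \<in> Q" using k q by (auto simp: Q_def)
    then show d: "\<delta> q = \<phi> q / nid (real q * \<beta> - \<gamma>')" by (simp add: \<delta>_def)
    have "1 / real q \<le> 1 / 2 ^ k" using qk q1 by (intro divide_left_mono) auto
    then have "\<phi> q \<le> 1 / 2 ^ k" by (simp add: \<phi>_def)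
    then have "\<delta> q \<le> (1 / 2 ^ k) / (1 / 2 ^ (3 * (k div L)))"
      unfolding d using q2(3) f0 p by (intro frac_le) auto
    then show le: "\<delta> q \<le> 2 ^ (3 * (k div L)) / 2 ^ k" by simp
    have "8 * (k div L) \<le> L * (k div L)" using L8 by (intro mult_right_mono) auto
    also have "\<dots> \<le> k" by simp
    finally have "3 * (k div L) + 1 \<le> k" using const(2)[OF k] by linarith
    then have "(2::real) ^ (3 * (k div L) + 1) \<le> 2 ^ k" by (intro power_increasing) auto
    then have "(2::real) ^ (3 * (k div L)) / 2 ^ k \<le> 1/2" by (simp add: field_simps)
    then show "\<delta> q \<le> 1/2" using le by linarith
  qed
  have supp: "\<exists>k\<ge>K0. q \<in> bohr \<beta> \<gamma>' L k" if "\<delta> q \<noteq> 0" for q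
    using that by (auto simp: \<delta>_def Q_def split: if_splits)
  have \<delta>0: "0 \<le> \<delta> q" for q
    using supp[of q] bohrD(4-6)[of _ q] by (cases "\<delta> q = 0") (auto simp: less_imp_le)
  interpret thin_radii \<beta> \<gamma> c \<rho> \<gamma>' L K0 \<delta>
  proof (intro thin_radii.intro thin_radii_axioms.intro)
    show "\<delta> q \<le> 1/2" for q using supp[of q] bohrD(8)[of _ q] by (cases "\<delta> q = 0") auto
    show "1 \<le> c * 2 ^ (K0 div L)" by (rule const) simp
  qed (use D rho supp \<delta>0 bohrD(7) in \<open>auto simp: L_def\<close>)
  have "\<not> summable \<delta>"
  proof
    assume sm: "summable \<delta>"
    define S where "S = suminf \<delta>"
    define h where "h j = 2 ^ j * \<psi> (2 ^ j)" for j :: nat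
    have h: "0 < h j" for j unfolding h_def by (simp add: pos)
    obtain K where K: "48 * real L * S < (\<Sum>j\<in>{Suc K0..<K}. real (j + 1) * min (h j) 1)"
      using dyadic_min_sum_unbounded[OF pos mono div] unfolding h_def by blast
    \<comment> \<open>On block \<open>k\<close> monotonicity bounds \<phi> below by its value at the
      right end 2^(k+1), hence the shift \<open>j = k + 1\<close>. The 48 is 3 from
      \<open>j + 1 \<le> 3 * L * t\<close>, 8 from \<open>sum_inverse_bohr_ge\<close> and 2 from 2^j
      = 2 * 2^k.\<close>
    have block: "real (j + 1) * min (h j) 1 \<le> 48 * real L * (\<Sum>q\<in>bohr \<beta> \<gamma>' L (j - 1). \<delta> q)"
      if "j \<in> {Suc K0..<K}" for j
    proof -
      define k where "k = j - 1"
      have k: "K0 \<le> k" "j = k + 1" using that by (auto simp: k_def)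
      define t where "t = k div L"
      have t4: "4 \<le> t" using const(2)[OF k(1)] by (simp add: t_def)
      have "k < L * (t + 1)" unfolding t_def using dividend_less_times_div[of L k] L8 by simp
      then have "j + 1 \<le> L * t + L + 1" using k by simp
      also have "\<dots> \<le> L * t + L * t + L * t"
        using t4 L8 by (intro add_mono) auto
      finally have "real (j + 1) \<le> real (3 * L * t)" by (intro of_nat_mono) simp
      then have "real (j + 1) * min (h j) 1 \<le> real (3 * L * t) * min (h j) 1"
        using h[of j] by (intro mult_right_mono) auto
      also have "\<dots> = 48 * real L * ((min (h j) 1 / 2 ^ j) * (real t * 2 ^ k / 8))"
        by (simp add: k field_simps)
      also have "\<dots> \<le> 48 * real L * ((min (h j) 1 / 2 ^ j) * (\<Sum>q\<in>bohr \<beta> \<gamma>' L k. 1 / nid (real q * \<beta> - \<gamma>')))"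
        unfolding t_def using h[of j] const[OF k(1)]
        by (intro mult_left_mono B.sum_inverse_bohr_ge) (auto simp: L_def)
      also have "\<dots> \<le> 48 * real L * (\<Sum>q\<in>bohr \<beta> \<gamma>' L k. \<delta> q)"
        unfolding sum_distrib_left
      proof (intro sum_mono mult_left_mono)
        fix q assume q: "q \<in> bohr \<beta> \<gamma>' L k"
        note qD = bohrD[OF k(1) q]
        have "min (h j) 1 / 2 ^ j = min (\<psi> (2 ^ j)) (1 / 2 ^ j)" by (simp add: h_def min_def field_simps)
        also have "\<dots> \<le> \<phi> q"
        proof -
          have "real q \<le> 2 ^ j" using qD(3) k(2) by (metis of_nat_le_iff of_nat_numeral of_nat_power)
          then have "1 / 2 ^ j \<le> 1 / real q" using qD(1) by (intro divide_left_mono) auto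
          then show ?thesis using mono[OF qD(1), of "2 ^ j"] qD(3) k(2) by (auto simp: \<phi>_def min_def)
        qed
        finally have "min (h j) 1 / 2 ^ j / nid (real q * \<beta> - \<gamma>') \<le> \<phi> q / nid (real q * \<beta> - \<gamma>')"
          by (rule divide_right_mono) simp
        then show "min (h j) 1 / 2 ^ j * (1 / nid (real q * \<beta> - \<gamma>')) \<le> \<delta> q"
          unfolding qD(6) by simp
      qed auto
      finally show ?thesis by (simp add: k_def)
    qed
    have "(\<Sum>j\<in>{Suc K0..<K}. real (j + 1) * min (h j) 1)
      \<le> (\<Sum>j\<in>{Suc K0..<K}. 48 * real L * (\<Sum>q\<in>bohr \<beta> \<gamma>' L (j - 1). \<delta> q))"
      by (intro sum_mono block)
    also have "\<dots> = 48 * real L * (\<Sum>j\<in>{Suc K0..<K}. \<Sum>q\<in>bohr \<beta> \<gamma>' L (j - 1). \<delta> q)"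
      by (simp only: sum_distrib_left)
    also have "(\<Sum>j\<in>{Suc K0..<K}. \<Sum>q\<in>bohr \<beta> \<gamma>' L (j - 1). \<delta> q)
      = (\<Sum>q\<in>(\<Union>j\<in>{Suc K0..<K}. bohr \<beta> \<gamma>' L (j - 1)). \<delta> q)"
    proof (rule sum.UNION_disjoint[symmetric])
      show "\<forall>i\<in>{Suc K0..<K}. \<forall>j\<in>{Suc K0..<K}. i \<noteq> j \<longrightarrow> bohr \<beta> \<gamma>' L (i - 1) \<inter> bohr \<beta> \<gamma>' L (j - 1) = {}"
      proof (intro ballI impI)
        fix i j assume "i \<in> {Suc K0..<K}" "j \<in> {Suc K0..<K}" "i \<noteq> j"
        then have "i - 1 \<noteq> j - 1" by auto
        then show "bohr \<beta> \<gamma>' L (i - 1) \<inter> bohr \<beta> \<gamma>' L (j - 1) = {}"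
          using bohr_block_unique by blast
      qed
    qed auto
    also have "\<dots> \<le> S" unfolding S_def using sm \<delta>0 by (intro sum_le_suminf) auto
    finally have "(\<Sum>j\<in>{Suc K0..<K}. real (j + 1) * min (h j) 1) \<le> 48 * real L * S"
      by (simp add: mult_left_mono)
    then show False using K by linarith
  qed
  then have "AE x in lborel. x \<in> {0..<1} \<longrightarrow> infinite {q. nid (real q * x - \<gamma>) < \<delta> q}"
    by (rule AE_infinite_near)
  then show ?thesis
  proof eventually_elim
    case (elim x)
    have "{q. nid (real q * x - \<gamma>) < \<delta> q}
      \<subseteq> {q. 1 \<le> q \<and> nid (real q * x - \<gamma>) * nid (real q * \<beta> - \<gamma>') < \<psi> q}"
    proof
      fix q assume "q \<in> {q. nid (real q * x - \<gamma>) < \<delta> q}"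
      then have lt: "nid (real q * x - \<gamma>) < \<delta> q" by simp
      then have "\<delta> q \<noteq> 0" using nid_nonneg[of "real q * x - \<gamma>"] by linarith
      then obtain k where k: "K0 \<le> k" "q \<in> bohr \<beta> \<gamma>' L k" using supp by blast
      note qD = bohrD[OF k]
      have "nid (real q * x - \<gamma>) * nid (real q * \<beta> - \<gamma>') < \<phi> q"
        using lt qD(4) unfolding qD(6) by (simp add: field_simps)
      then show "q \<in> {q. 1 \<le> q \<and> nid (real q * x - \<gamma>) * nid (real q * \<beta> - \<gamma>') < \<psi> q}"
        using qD(1) by (simp add: \<phi>_def)
    qed
    then show ?case using elim infinite_super unfolding W_def by fastforce
  qed
qed

theorem theorem1p8:
  fixes \<psi> :: "nat \<Rightarrow> real" and \<beta> \<gamma> \<gamma>' :: real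
  assumes psi_pos: "\<And>q. q \<ge> 1 \<Longrightarrow> \<psi> q > 0"
    and psi_noninc: "\<And>q r. 1 \<le> q \<Longrightarrow> q \<le> r \<Longrightarrow> \<psi> r \<le> \<psi> q"
    and gamma_irrational: "\<gamma> \<notin> \<rat>"
    and beta_irrational: "\<beta> \<notin> \<rat>"
    and diophantine: "Diophantine_pair \<gamma> \<beta>"
    and diverges: "filterlim (\<lambda>N. \<Sum>q=1..N. \<psi> q * log 2 (real q)) at_top sequentially"
  shows "emeasure lebesgue (W \<psi> \<beta> \<gamma> \<gamma>') = 1"
proof -
  let ?W = "W \<psi> \<beta> \<gamma> \<gamma>'"
  obtain c :: real and \<rho> :: nat where "2 \<le> \<rho>" "diophantine_real \<beta> c \<rho>" "diophantine_real \<gamma> c \<rho>"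
    using Diophantine_pair_D[OF diophantine] by blast
  then have "AE x in lborel. x \<in> {0..<1} \<longrightarrow> x \<in> ?W"
    by (intro AE_in_W psi_pos psi_noninc diverges)
  then have "AE x in lborel. x \<in> {0..1} \<longrightarrow> x \<in> ?W"
    using AE_lborel_singleton[of 1]
  proof eventually_elim
    case (elim x)
    then show ?case by (cases "x = 1") auto
  qed
  then obtain N where N: "{x \<in> space lborel. \<not> (x \<in> {0..1} \<longrightarrow> x \<in> ?W)} \<subseteq> N"
      "emeasure lborel N = 0" "N \<in> sets lborel"
    by (rule AE_E)
  \<comment> \<open>The complement of \<open>?W\<close> in the unit interval lies in a Borel null
    set, so completeness of \<open>lebesgue\<close> makes it null; this also yields the
    measurability of \<open>?W\<close>.\<close>
  have "{0..1} - ?W \<subseteq> N" using N(1) by auto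
  moreover have "N \<in> null_sets lebesgue" using N(2,3) by (intro null_sets_completionI null_setsI)
  ultimately have "{0..1} - ?W \<in> null_sets lebesgue" by (rule null_sets_completion_subset)
  moreover have "?W = {0..1} - ({0..1} - ?W)" by (auto simp: W_def)
  ultimately have "emeasure lebesgue ?W = emeasure lebesgue {0..1::real}"
    by (metis emeasure_Diff_null_set lmeasurable_interval(1) fmeasurableD)
  then show ?thesis by simp
qed

end
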